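(* Let $G$ be a group such that $\overline{G}[x]$ is polycyclic; then $\overline{G}[x_{1},\ldots,x_{n}]$ is polycyclic for any positive integer $n$.
   Context: Let $G$ be a group, $n$ a positive integer, and $F_n$ the free group freely generated by $x_1,\ldots,x_n$. Put $G[x_1,\ldots,x_n] := G * F_n$ (free product). Each element $f(x_1,\ldots,x_n)\in G[x_1,\ldots,x_n]$ defines a map $G^n\to G$, $(t_1,\ldots,t_n)\mapsto f(t_1,\ldots,t_n)$, obtained by substituting $t_i$ for $x_i$ (i.e. applying the homomorphism $G*F_n\to G$ that is the identity on $G$ and sends $x_i$ to $t_i$). Such maps are called polynomial functions, and $\overline{G}[x_1,\ldots,x_n]$ denotes the set of all of them. It is a group under the pointwise product: the product of $(t_1,\ldots,t_n)\mapsto f(t_1,\ldots,t_n)$ and $(t_1,\ldots,t_n)\mapsto g(t_1,\ldots,t_n)$ is $(t_1,\ldots,t_n)\mapsto f(t_1,\ldots,t_n)g(t_1,\ldots,t_n)$. When $n=1$, one writes $\overline{G}[x]$ instead of $\overline{G}[x_1]$. A Noetherian group is a group satisfying the maximal condition for its subgroups; a polycyclic group is a soluble Noetherian group. *)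

theory Defs
  imports "HOL-Algebra.Solvable_Groups"
begin

section \<open>Words modulo a congruence\<close>

text \<open>Free groups and free products are both built as words over a set \<open>L\<close> of letters modulo
  the least monoid congruence containing a set \<open>R\<close> of relations.\<close>

inductive_set word_cong :: "'l set \<Rightarrow> ('l list \<times> 'l list) set \<Rightarrow> ('l list \<times> 'l list) set"
  for L R where
  base: "\<lbrakk>(u, v) \<in> R; u \<in> lists L; v \<in> lists L\<rbrakk> \<Longrightarrow> (u, v) \<in> word_cong L R"
| refl: "u \<in> lists L \<Longrightarrow> (u, u) \<in> word_cong L R"
| sym: "(u, v) \<in> word_cong L R \<Longrightarrow> (v, u) \<in> word_cong L R"
| trans: "\<lbrakk>(u, v) \<in> word_cong L R; (v, w) \<in> word_cong L R\<rbrakk> \<Longrightarrow> (u, w) \<in> word_cong L R"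
| append: "\<lbrakk>(u, v) \<in> word_cong L R; (u', v') \<in> word_cong L R\<rbrakk> \<Longrightarrow>
    (u @ u', v @ v') \<in> word_cong L R"

definition presented_monoid :: "'l set \<Rightarrow> ('l list \<times> 'l list) set \<Rightarrow> 'l list set monoid" where
  "presented_monoid L R =
    \<lparr>carrier = lists L // word_cong L R,
     mult = (\<lambda>A B. \<Union>u\<in>A. \<Union>v\<in>B. word_cong L R `` {u @ v}),
     one = word_cong L R `` {[]}\<rparr>"

definition word_eval :: "('a, 'm) monoid_scheme \<Rightarrow> ('l \<Rightarrow> 'a) \<Rightarrow> 'l list \<Rightarrow> 'a" where
  "word_eval K \<phi> w = foldr (\<lambda>l y. \<phi> l \<otimes>\<^bsub>K\<^esub> y) w \<one>\<^bsub>K\<^esub>"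

text \<open>The value on a class is the common value of \<open>word_eval K \<phi>\<close> on its words; this is
  meaningful when \<open>\<phi>\<close> respects the relations (lemma \<open>presented_lift_class\<close> below).\<close>

definition presented_lift :: "('a, 'm) monoid_scheme \<Rightarrow> ('l \<Rightarrow> 'a) \<Rightarrow> 'l list set \<Rightarrow> 'a" where
  "presented_lift K \<phi> W = the_elem (word_eval K \<phi> ` W)"

section \<open>Free groups and free products\<close>

text \<open>The letter \<open>(x, True)\<close> stands for the generator \<open>x\<close> and \<open>(x, False)\<close> for its inverse.\<close>

definition free_group_letters :: "'x set \<Rightarrow> ('x \<times> bool) set" where
  "free_group_letters X = X \<times> UNIV"

definition free_group_rels :: "(('x \<times> bool) list \<times> ('x \<times> bool) list) set" where
  "free_group_rels = {([(x, b), (x, \<not> b)], []) | x b. True}"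

definition free_group :: "'x set \<Rightarrow> ('x \<times> bool) list set monoid" where
  "free_group X = presented_monoid (free_group_letters X) free_group_rels"

definition free_group_gen :: "'x set \<Rightarrow> 'x \<Rightarrow> ('x \<times> bool) list set" where
  "free_group_gen X x = word_cong (free_group_letters X) free_group_rels `` {[(x, True)]}"

definition free_group_lift ::
    "('a, 'm) monoid_scheme \<Rightarrow> ('x \<Rightarrow> 'a) \<Rightarrow> ('x \<times> bool) list set \<Rightarrow> 'a" where
  "free_group_lift K t = presented_lift K (\<lambda>(x, b). if b then t x else inv\<^bsub>K\<^esub> (t x))"

definition free_product_letters ::
    "('a, 'm) monoid_scheme \<Rightarrow> ('b, 'k) monoid_scheme \<Rightarrow> ('a + 'b) set" where
  "free_product_letters G H = carrier G <+> carrier H"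

definition free_product_rels ::
    "('a, 'm) monoid_scheme \<Rightarrow> ('b, 'k) monoid_scheme \<Rightarrow> (('a + 'b) list \<times> ('a + 'b) list) set" where
  "free_product_rels G H =
     {([Inl \<one>\<^bsub>G\<^esub>], []), ([Inr \<one>\<^bsub>H\<^esub>], [])} \<union>
     {([Inl a, Inl b], [Inl (a \<otimes>\<^bsub>G\<^esub> b)]) | a b. a \<in> carrier G \<and> b \<in> carrier G} \<union>
     {([Inr a, Inr b], [Inr (a \<otimes>\<^bsub>H\<^esub> b)]) | a b. a \<in> carrier H \<and> b \<in> carrier H}"

definition free_product ::
    "('a, 'm) monoid_scheme \<Rightarrow> ('b, 'k) monoid_scheme \<Rightarrow> ('a + 'b) list set monoid" where
  "free_product G H = presented_monoid (free_product_letters G H) (free_product_rels G H)"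

definition free_product_class ::
    "('a, 'm) monoid_scheme \<Rightarrow> ('b, 'k) monoid_scheme \<Rightarrow> 'a + 'b \<Rightarrow> ('a + 'b) list set" where
  "free_product_class G H l = word_cong (free_product_letters G H) (free_product_rels G H) `` {[l]}"

definition free_product_lift ::
    "('c, 'n) monoid_scheme \<Rightarrow> ('a \<Rightarrow> 'c) \<Rightarrow> ('b \<Rightarrow> 'c) \<Rightarrow> ('a + 'b) list set \<Rightarrow> 'c" where
  "free_product_lift K \<phi> \<psi> = presented_lift K (case_sum \<phi> \<psi>)"

section \<open>Polynomials and polynomial functions over a group\<close>

text \<open>\<open>F\<^sub>n\<close> is the free group on \<open>{1..n}\<close>, and \<open>G\<^sup>n\<close> is the set of functions from \<open>{1..n}\<close> to the
  carrier. Polynomial functions are made extensional (\<open>undefined\<close> outside \<open>G\<^sup>n\<close>), so that they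
  are equal iff they agree on \<open>G\<^sup>n\<close>.\<close>

definition group_polynomials ::
    "('a, 'm) monoid_scheme \<Rightarrow> nat \<Rightarrow> ('a + (nat \<times> bool) list set) list set monoid" where
  "group_polynomials G n = free_product G (free_group {1..n})"

definition group_power :: "('a, 'm) monoid_scheme \<Rightarrow> nat \<Rightarrow> (nat \<Rightarrow> 'a) set" where
  "group_power G n = {1..n} \<rightarrow>\<^sub>E carrier G"

definition polynomial_subst ::
    "('a, 'm) monoid_scheme \<Rightarrow> (nat \<Rightarrow> 'a) \<Rightarrow> ('a + (nat \<times> bool) list set) list set \<Rightarrow> 'a" where
  "polynomial_subst G t = free_product_lift G (\<lambda>g. g) (free_group_lift G t)"

definition polynomial_function ::
    "('a, 'm) monoid_scheme \<Rightarrow> nat \<Rightarrow> ('a + (nat \<times> bool) list set) list set \<Rightarrow> (nat \<Rightarrow> 'a) \<Rightarrow> 'a" where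
  "polynomial_function G n f = (\<lambda>t\<in>group_power G n. polynomial_subst G t f)"

definition polynomial_functions ::
    "('a, 'm) monoid_scheme \<Rightarrow> nat \<Rightarrow> ((nat \<Rightarrow> 'a) \<Rightarrow> 'a) monoid" where
  "polynomial_functions G n =
    \<lparr>carrier = polynomial_function G n ` carrier (group_polynomials G n),
     mult = (\<lambda>p q. \<lambda>t\<in>group_power G n. p t \<otimes>\<^bsub>G\<^esub> q t),
     one = (\<lambda>t\<in>group_power G n. \<one>\<^bsub>G\<^esub>)\<rparr>"

section \<open>Noetherian and polycyclic groups\<close>

definition noetherian_group :: "('a, 'm) monoid_scheme \<Rightarrow> bool" where
  "noetherian_group G \<longleftrightarrow> group G \<and>
     (\<forall>S. S \<noteq> {} \<and> (\<forall>H\<in>S. subgroup H G) \<longrightarrow> (\<exists>M\<in>S. \<forall>H\<in>S. M \<subseteq> H \<longrightarrow> H = M))"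

definition polycyclic_group :: "('a, 'm) monoid_scheme \<Rightarrow> bool" where
  "polycyclic_group G \<longleftrightarrow> noetherian_group G \<and> solvable G"

section \<open>The constructions are as intended\<close>

lemma word_cong_lists:
  assumes "(u, v) \<in> word_cong L R" shows "u \<in> lists L \<and> v \<in> lists L"
  using assms by induction auto

lemma equiv_word_cong: "equiv (lists L) (word_cong L R)"
proof (rule equivI)
  show "word_cong L R \<subseteq> lists L \<times> lists L" using word_cong_lists by fastforce
  show "refl_on (lists L) (word_cong L R)" by (rule refl_onI) (rule word_cong.refl)
  show "Relation.sym (word_cong L R)" by (rule symI) (rule word_cong.sym)
  show "Relation.trans (word_cong L R)" by (rule transI) (rule word_cong.trans)
qed

lemma presented_carrierE:
  assumes "A \<in> carrier (presented_monoid L R)"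
  obtains w where "w \<in> lists L" "A = word_cong L R `` {w}"
proof -
  have "A \<in> lists L // word_cong L R" using assms by (simp add: presented_monoid_def)
  then show ?thesis by (rule quotientE) (rule that)
qed

lemma presented_class_carrier:
  "w \<in> lists L \<Longrightarrow> word_cong L R `` {w} \<in> carrier (presented_monoid L R)"
  unfolding presented_monoid_def by (auto intro: quotientI)

lemma presented_class_eq:
  "(u, v) \<in> word_cong L R \<Longrightarrow> word_cong L R `` {u} = word_cong L R `` {v}"
  by (rule equiv_class_eq[OF equiv_word_cong])

lemma presented_mult:
  assumes "u \<in> lists L" "v \<in> lists L"
  shows "(word_cong L R `` {u}) \<otimes>\<^bsub>presented_monoid L R\<^esub> (word_cong L R `` {v})
       = word_cong L R `` {u @ v}"
proof -
  have "word_cong L R `` {u' @ v'} = word_cong L R `` {u @ v}"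
    if "u' \<in> word_cong L R `` {u}" "v' \<in> word_cong L R `` {v}" for u' v'
    using presented_class_eq[OF word_cong.append[of u u' L R v v']] that by simp
  moreover have "u \<in> word_cong L R `` {u}" "v \<in> word_cong L R `` {v}"
    using assms by (auto intro: word_cong.refl)
  ultimately have "(\<Union>u'\<in>word_cong L R `` {u}. \<Union>v'\<in>word_cong L R `` {v}. word_cong L R `` {u' @ v'})
      = word_cong L R `` {u @ v}"
    by blast
  then show ?thesis by (simp add: presented_monoid_def)
qed

lemma presented_one: "\<one>\<^bsub>presented_monoid L R\<^esub> = word_cong L R `` {[]}"
  by (simp add: presented_monoid_def)

lemma monoid_presented: "monoid (presented_monoid L R)"
proof (rule monoidI)
  let ?P = "presented_monoid L R" and ?c = "\<lambda>w. word_cong L R `` {w}"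
  show "\<one>\<^bsub>?P\<^esub> \<in> carrier ?P"
    unfolding presented_one by (rule presented_class_carrier) simp
  fix x assume "x \<in> carrier ?P"
  then obtain u where u: "u \<in> lists L" and x: "x = ?c u" by (rule presented_carrierE)
  show "\<one>\<^bsub>?P\<^esub> \<otimes>\<^bsub>?P\<^esub> x = x"
    unfolding x presented_one using presented_mult[OF lists.Nil u] by simp
  show "x \<otimes>\<^bsub>?P\<^esub> \<one>\<^bsub>?P\<^esub> = x"
    unfolding x presented_one using presented_mult[OF u lists.Nil] by simp
  fix y assume "y \<in> carrier ?P"
  then obtain v where v: "v \<in> lists L" and y: "y = ?c v" by (rule presented_carrierE)
  have uv: "u @ v \<in> lists L" using u v by simp
  show "x \<otimes>\<^bsub>?P\<^esub> y \<in> carrier ?P"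
    unfolding x y presented_mult[OF u v] by (rule presented_class_carrier[OF uv])
  fix z assume "z \<in> carrier ?P"
  then obtain w where w: "w \<in> lists L" and z: "z = ?c w" by (rule presented_carrierE)
  have vw: "v @ w \<in> lists L" using v w by simp
  show "x \<otimes>\<^bsub>?P\<^esub> y \<otimes>\<^bsub>?P\<^esub> z = x \<otimes>\<^bsub>?P\<^esub> (y \<otimes>\<^bsub>?P\<^esub> z)"
    unfolding x y z presented_mult[OF u v] presented_mult[OF v w]
      presented_mult[OF uv w] presented_mult[OF u vw] by simp
qed

lemma group_presented:
  assumes "\<And>l. l \<in> L \<Longrightarrow> \<exists>l'\<in>L. ([l', l], []) \<in> word_cong L R"
  shows "group (presented_monoid L R)"
proof -
  have inverse: "\<exists>v\<in>lists L. (v @ w, []) \<in> word_cong L R" if "w \<in> lists L" for w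
    using that
  proof induction
    case Nil
    then show ?case by (auto intro!: bexI[of _ "[]"] word_cong.refl)
  next
    case (Cons l w)
    obtain l' where l': "l' \<in> L" "([l', l], []) \<in> word_cong L R" using assms Cons.hyps by blast
    obtain v where v: "v \<in> lists L" "(v @ w, []) \<in> word_cong L R" using Cons.IH by blast
    have "(v @ [l', l], v @ []) \<in> word_cong L R"
      by (intro word_cong.append word_cong.refl l' v)
    then have "((v @ [l', l]) @ w, (v @ []) @ w) \<in> word_cong L R"
      by (intro word_cong.append[OF _ word_cong.refl] Cons.hyps)
    then have "((v @ [l']) @ l # w, []) \<in> word_cong L R"
      using word_cong.trans[OF _ v(2)] by simp
    then show ?case using v l' by (intro bexI[of _ "v @ [l']"]) auto
  qed
  have "\<exists>B\<in>carrier (presented_monoid L R). B \<otimes>\<^bsub>presented_monoid L R\<^esub> A = \<one>\<^bsub>presented_monoid L R\<^esub>"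
    if "A \<in> carrier (presented_monoid L R)" for A
  proof -
    obtain w where w: "w \<in> lists L" "A = word_cong L R `` {w}"
      using \<open>A \<in> _\<close> by (rule presented_carrierE)
    obtain v where v: "v \<in> lists L" "(v @ w, []) \<in> word_cong L R"
      using inverse[OF w(1)] by blast
    show ?thesis
      using presented_mult[OF v(1) w(1), of R] presented_class_eq[OF v(2)] w(2)
        presented_class_carrier[OF v(1), of R]
      by (auto simp: presented_one)
  qed
  then show ?thesis
    using monoid_presented[of L R] by (intro groupI) (auto simp: monoid.m_assoc monoid.m_closed)
qed

lemma group_free_group: "group (free_group X)"
  unfolding free_group_def
proof (rule group_presented)
  fix l :: "'a \<times> bool" assume l: "l \<in> free_group_letters X"
  obtain x b where [simp]: "l = (x, b)" by (cases l)
  have x: "x \<in> X" using l by (auto simp: free_group_letters_def)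
  have rel: "([(x, \<not> b), (x, b)], []) \<in> free_group_rels"
    unfolding free_group_rels_def by (intro CollectI exI[of _ x] exI[of _ "\<not> b"]) simp
  have "([(x, \<not> b), l], []) \<in> word_cong (free_group_letters X) free_group_rels"
    by (rule word_cong.base) (use rel x in \<open>simp_all add: free_group_letters_def\<close>)
  then show "\<exists>l'\<in>free_group_letters X.
      ([l', l], []) \<in> word_cong (free_group_letters X) free_group_rels"
    using x by (intro bexI[of _ "(x, \<not> b)"]) (simp_all add: free_group_letters_def)
qed

lemma group_free_product:
  assumes "group G" "group H" shows "group (free_product G H)"
proof -
  interpret G: group G by fact
  interpret H: group H by fact
  let ?L = "free_product_letters G H" and ?R = "free_product_rels G H"
  have "\<exists>l'\<in>?L. ([l', l], []) \<in> word_cong ?L ?R" if "l \<in> ?L" for l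
  proof (cases l)
    case (Inl a)
    then have a: "a \<in> carrier G" using that by (auto simp: free_product_letters_def)
    have "([Inl (inv\<^bsub>G\<^esub> a), Inl a], [Inl (inv\<^bsub>G\<^esub> a \<otimes>\<^bsub>G\<^esub> a)]) \<in> word_cong ?L ?R"
      using a by (intro word_cong.base) (auto simp: free_product_letters_def free_product_rels_def)
    moreover have "([Inl \<one>\<^bsub>G\<^esub>], []) \<in> word_cong ?L ?R"
      by (intro word_cong.base) (auto simp: free_product_letters_def free_product_rels_def)
    ultimately have "([Inl (inv\<^bsub>G\<^esub> a), Inl a], []) \<in> word_cong ?L ?R"
      using a word_cong.trans by fastforce
    then show ?thesis using a Inl by (intro bexI[of _ "Inl (inv\<^bsub>G\<^esub> a)"]) (auto simp: free_product_letters_def)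
  next
    case (Inr a)
    then have a: "a \<in> carrier H" using that by (auto simp: free_product_letters_def)
    have "([Inr (inv\<^bsub>H\<^esub> a), Inr a], [Inr (inv\<^bsub>H\<^esub> a \<otimes>\<^bsub>H\<^esub> a)]) \<in> word_cong ?L ?R"
      using a by (intro word_cong.base) (auto simp: free_product_letters_def free_product_rels_def)
    moreover have "([Inr \<one>\<^bsub>H\<^esub>], []) \<in> word_cong ?L ?R"
      by (intro word_cong.base) (auto simp: free_product_letters_def free_product_rels_def)
    ultimately have "([Inr (inv\<^bsub>H\<^esub> a), Inr a], []) \<in> word_cong ?L ?R"
      using a word_cong.trans by fastforce
    then show ?thesis using a Inr by (intro bexI[of _ "Inr (inv\<^bsub>H\<^esub> a)"]) (auto simp: free_product_letters_def)
  qed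
  then show ?thesis unfolding free_product_def by (rule group_presented)
qed

lemma word_eval_closed:
  assumes "monoid K" "w \<in> lists L" "\<And>l. l \<in> L \<Longrightarrow> \<phi> l \<in> carrier K"
  shows "word_eval K \<phi> w \<in> carrier K"
  using assms(2) by induction (auto simp: word_eval_def assms monoid.m_closed)

lemma word_eval_append:
  assumes "monoid K" "u \<in> lists L" "v \<in> lists L" "\<And>l. l \<in> L \<Longrightarrow> \<phi> l \<in> carrier K"
  shows "word_eval K \<phi> (u @ v) = word_eval K \<phi> u \<otimes>\<^bsub>K\<^esub> word_eval K \<phi> v"
  using assms(2)
proof induction
  case Nil
  then show ?case using word_eval_closed[OF assms(1,3,4)] assms(1)
    by (simp add: word_eval_def monoid.l_one)
next
  case (Cons l w)
  then show ?case
    using word_eval_closed[OF assms(1,3,4)] word_eval_closed[OF assms(1) Cons.hyps(2) assms(4)] assms(1)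
    by (simp add: word_eval_def monoid.m_assoc assms(4))
qed

lemma word_eval_cong:
  assumes "(u, v) \<in> word_cong L R" "monoid K" "\<And>l. l \<in> L \<Longrightarrow> \<phi> l \<in> carrier K"
    and "\<And>u v. \<lbrakk>(u, v) \<in> R; u \<in> lists L; v \<in> lists L\<rbrakk> \<Longrightarrow> word_eval K \<phi> u = word_eval K \<phi> v"
  shows "word_eval K \<phi> u = word_eval K \<phi> v"
  using assms(1)
proof induction
  case (append u v u' v')
  note l = word_cong_lists[OF append.hyps(1)] word_cong_lists[OF append.hyps(2)]
  have "word_eval K \<phi> (u @ u') = word_eval K \<phi> u \<otimes>\<^bsub>K\<^esub> word_eval K \<phi> u'"
    by (rule word_eval_append[OF assms(2) l(1)[THEN conjunct1] l(2)[THEN conjunct1] assms(3)])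
  moreover have "word_eval K \<phi> (v @ v') = word_eval K \<phi> v \<otimes>\<^bsub>K\<^esub> word_eval K \<phi> v'"
    by (rule word_eval_append[OF assms(2) l(1)[THEN conjunct2] l(2)[THEN conjunct2] assms(3)])
  ultimately show ?case by (simp only: append.IH)
next
  case (base u v)
  then show ?case by (rule assms(4))
next
  case (trans u v w)
  then show ?case by simp
qed simp_all

lemma presented_lift_class:
  assumes "w \<in> lists L" "monoid K" "\<And>l. l \<in> L \<Longrightarrow> \<phi> l \<in> carrier K"
    and "\<And>u v. \<lbrakk>(u, v) \<in> R; u \<in> lists L; v \<in> lists L\<rbrakk> \<Longrightarrow> word_eval K \<phi> u = word_eval K \<phi> v"
  shows "presented_lift K \<phi> (word_cong L R `` {w}) = word_eval K \<phi> w"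
proof -
  let ?W = "word_cong L R `` {w}"
  have "word_eval K \<phi> v = word_eval K \<phi> w" if "v \<in> ?W" for v
  proof -
    have "(w, v) \<in> word_cong L R" using that by simp
    then have "word_eval K \<phi> w = word_eval K \<phi> v"
      by (rule word_eval_cong[OF _ assms(2)]) (fact assms)+
    then show ?thesis by (rule HOL.sym)
  qed
  then have "word_eval K \<phi> ` ?W = (\<lambda>_. word_eval K \<phi> w) ` ?W"
    by (rule image_cong[OF HOL.refl])
  moreover have "w \<in> ?W" using word_cong.refl[OF assms(1)] by simp
  ultimately have "word_eval K \<phi> ` ?W = {word_eval K \<phi> w}"
    using image_constant by metis
  then show ?thesis by (simp add: presented_lift_def)
qed

lemma presented_lift_hom:
  assumes "monoid K" "\<And>l. l \<in> L \<Longrightarrow> \<phi> l \<in> carrier K"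
    and "\<And>u v. \<lbrakk>(u, v) \<in> R; u \<in> lists L; v \<in> lists L\<rbrakk> \<Longrightarrow> word_eval K \<phi> u = word_eval K \<phi> v"
  shows "presented_lift K \<phi> \<in> hom (presented_monoid L R) K"
proof (rule homI)
  have lift: "presented_lift K \<phi> (word_cong L R `` {w}) = word_eval K \<phi> w" if "w \<in> lists L" for w
    by (rule presented_lift_class[OF that assms(1)]) (fact assms)+
  fix A assume "A \<in> carrier (presented_monoid L R)"
  then obtain u where u: "u \<in> lists L" "A = word_cong L R `` {u}" by (rule presented_carrierE)
  show "presented_lift K \<phi> A \<in> carrier K"
    unfolding u(2) lift[OF u(1)] by (rule word_eval_closed[OF assms(1) u(1)]) (fact assms)
  fix B assume "B \<in> carrier (presented_monoid L R)"
  then obtain v where v: "v \<in> lists L" "B = word_cong L R `` {v}" by (rule presented_carrierE)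
  have "u @ v \<in> lists L" using u v by simp
  moreover have "word_eval K \<phi> (u @ v) = word_eval K \<phi> u \<otimes>\<^bsub>K\<^esub> word_eval K \<phi> v"
    by (rule word_eval_append[OF assms(1) u(1) v(1)]) (fact assms)
  ultimately show "presented_lift K \<phi> (A \<otimes>\<^bsub>presented_monoid L R\<^esub> B)
      = presented_lift K \<phi> A \<otimes>\<^bsub>K\<^esub> presented_lift K \<phi> B"
    by (simp only: u(2) v(2) presented_mult[OF u(1) v(1)] lift u(1) v(1))
qed

lemma presented_hom_eqI:
  assumes "h \<in> hom (presented_monoid L R) K" "k \<in> hom (presented_monoid L R) K"
    and "group (presented_monoid L R)" "group K"
    and "\<And>l. l \<in> L \<Longrightarrow> h (word_cong L R `` {[l]}) = k (word_cong L R `` {[l]})"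
    and "A \<in> carrier (presented_monoid L R)"
  shows "h A = k A"
proof -
  obtain w where w: "w \<in> lists L" and A: "A = word_cong L R `` {w}"
    using assms(6) by (rule presented_carrierE)
  from w have "h (word_cong L R `` {w}) = k (word_cong L R `` {w})"
  proof induction
    case Nil
    then show ?case using hom_one[OF assms(1,3,4)] hom_one[OF assms(2,3,4)]
      by (simp add: presented_one)
  next
    case (Cons l w)
    have l: "[l] \<in> lists L" using Cons.hyps by auto
    note car = presented_class_carrier[OF l] presented_class_carrier[OF Cons.hyps(2)]
    have "word_cong L R `` {l # w}
        = (word_cong L R `` {[l]}) \<otimes>\<^bsub>presented_monoid L R\<^esub> (word_cong L R `` {w})"
      using presented_mult[OF l Cons.hyps(2)] by simp
    then show ?case
      using hom_mult[OF assms(1) car] hom_mult[OF assms(2) car] Cons.IH assms(5)[OF Cons.hyps(1)]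
      by simp
  qed
  then show ?thesis by (simp add: A)
qed

lemma free_group_gen_carrier:
  "x \<in> X \<Longrightarrow> free_group_gen X x \<in> carrier (free_group X)"
  unfolding free_group_gen_def free_group_def
  by (rule presented_class_carrier) (auto simp: free_group_letters_def)

lemma free_group_lift_hom:
  assumes "group K" "\<And>x. x \<in> X \<Longrightarrow> t x \<in> carrier K"
  shows "free_group_lift K t \<in> hom (free_group X) K"
    and "x \<in> X \<Longrightarrow> free_group_lift K t (free_group_gen X x) = t x"
proof -
  interpret K: group K by fact
  let ?\<phi> = "\<lambda>(x, b). if b then t x else inv\<^bsub>K\<^esub> (t x)"
  have 1: "?\<phi> l \<in> carrier K" if "l \<in> free_group_letters X" for l
    using that assms(2) by (auto simp: free_group_letters_def)
  have 2: "word_eval K ?\<phi> u = word_eval K ?\<phi> v"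
    if "(u, v) \<in> free_group_rels" "u \<in> lists (free_group_letters X)"
      "v \<in> lists (free_group_letters X)" for u v
    using that assms(2) by (auto simp: free_group_rels_def word_eval_def free_group_letters_def)
  show "free_group_lift K t \<in> hom (free_group X) K"
    unfolding free_group_lift_def free_group_def
    by (rule presented_lift_hom[OF K.monoid_axioms]) (fact 1 2)+
  assume x: "x \<in> X"
  then have "[(x, True)] \<in> lists (free_group_letters X)" by (auto simp: free_group_letters_def)
  then have "presented_lift K ?\<phi> (word_cong (free_group_letters X) free_group_rels `` {[(x, True)]})
      = word_eval K ?\<phi> [(x, True)]"
    by (rule presented_lift_class[OF _ K.monoid_axioms]) (fact 1 2)+
  then show "free_group_lift K t (free_group_gen X x) = t x"
    using x assms(2) by (simp add: free_group_lift_def free_group_gen_def word_eval_def)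
qed

lemma free_group_hom_eqI:
  assumes "group K" "h \<in> hom (free_group X) K" "k \<in> hom (free_group X) K"
    and gen: "\<And>x. x \<in> X \<Longrightarrow> h (free_group_gen X x) = k (free_group_gen X x)"
    and "A \<in> carrier (free_group X)"
  shows "h A = k A"
  using assms(2,3) group_free_group[of X] assms(1) _ assms(5) unfolding free_group_def
proof (rule presented_hom_eqI)
  let ?c = "\<lambda>l. word_cong (free_group_letters X) free_group_rels `` {[l]}"
  fix l assume l: "l \<in> free_group_letters X"
  obtain x b where lx: "l = (x, b)" by (cases l)
  then have x: "x \<in> X" using l by (auto simp: free_group_letters_def)
  interpret F: group "free_group X" by (rule group_free_group)
  interpret K: group K by fact
  interpret h: group_hom "free_group X" K h by unfold_locales fact
  interpret k: group_hom "free_group X" K k by unfold_locales fact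
  show "h (?c l) = k (?c l)"
  proof (cases b)
    case True
    then show ?thesis using gen[OF x] by (simp add: lx free_group_gen_def)
  next
    case False
    have lists: "[(x, False)] \<in> lists (free_group_letters X)" "[(x, True)] \<in> lists (free_group_letters X)"
      using x by (auto simp: free_group_letters_def)
    have "([(x, False), (x, True)], []) \<in> word_cong (free_group_letters X) free_group_rels"
      using x by (intro word_cong.base) (auto simp: free_group_letters_def free_group_rels_def)
    then have "?c (x, False) \<otimes>\<^bsub>free_group X\<^esub> free_group_gen X x = \<one>\<^bsub>free_group X\<^esub>"
      unfolding free_group_gen_def free_group_def presented_mult[OF lists] presented_one
      by (auto dest: presented_class_eq)
    moreover have "?c (x, False) \<in> carrier (free_group X)"
      unfolding free_group_def by (rule presented_class_carrier[OF lists(1)])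
    ultimately have "?c l = inv\<^bsub>free_group X\<^esub> free_group_gen X x"
      using F.inv_equality[of _ "free_group_gen X x"] free_group_gen_carrier[OF x] False lx by simp
    then show ?thesis
      using gen[OF x] free_group_gen_carrier[OF x] by simp
  qed
qed

lemma free_product_class_carrier:
  "l \<in> free_product_letters G H \<Longrightarrow> free_product_class G H l \<in> carrier (free_product G H)"
  unfolding free_product_class_def free_product_def
  by (rule presented_class_carrier) auto

lemma free_product_class_hom:
  assumes "group G" "group H"
  shows "(\<lambda>a. free_product_class G H (Inl a)) \<in> hom G (free_product G H)"
    and "(\<lambda>b. free_product_class G H (Inr b)) \<in> hom H (free_product G H)"
proof -
  interpret G: group G by fact
  interpret H: group H by fact
  let ?L = "free_product_letters G H" and ?R = "free_product_rels G H"
  have mult: "free_product_class G H l''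
      = free_product_class G H l \<otimes>\<^bsub>free_product G H\<^esub> free_product_class G H l'"
    if "([l, l'], [l'']) \<in> word_cong ?L ?R" for l l' l''
  proof -
    have "[l] \<in> lists ?L" "[l'] \<in> lists ?L" using word_cong_lists[OF that] by auto
    from presented_mult[OF this] show ?thesis
      using presented_class_eq[OF that] by (simp add: free_product_class_def free_product_def)
  qed
  show "(\<lambda>a. free_product_class G H (Inl a)) \<in> hom G (free_product G H)"
    by (intro homI free_product_class_carrier mult word_cong.base)
      (auto simp: free_product_letters_def free_product_rels_def)
  show "(\<lambda>b. free_product_class G H (Inr b)) \<in> hom H (free_product G H)"
    by (intro homI free_product_class_carrier mult word_cong.base)
      (auto simp: free_product_letters_def free_product_rels_def)
qed

lemma free_product_lift_hom:
  assumes "group G" "group H" "group K" "\<phi> \<in> hom G K" "\<psi> \<in> hom H K"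
  shows "free_product_lift K \<phi> \<psi> \<in> hom (free_product G H) K"
    and "a \<in> carrier G \<Longrightarrow> free_product_lift K \<phi> \<psi> (free_product_class G H (Inl a)) = \<phi> a"
    and "b \<in> carrier H \<Longrightarrow> free_product_lift K \<phi> \<psi> (free_product_class G H (Inr b)) = \<psi> b"
proof -
  interpret K: group K by fact
  interpret \<phi>: group_hom G K \<phi> using assms by (simp add: group_hom_def group_hom_axioms_def)
  interpret \<psi>: group_hom H K \<psi> using assms by (simp add: group_hom_def group_hom_axioms_def)
  let ?\<chi> = "case_sum \<phi> \<psi>"
  have 1: "?\<chi> l \<in> carrier K" if "l \<in> free_product_letters G H" for l
    using that by (auto simp: free_product_letters_def)
  have 2: "word_eval K ?\<chi> u = word_eval K ?\<chi> v"
    if "(u, v) \<in> free_product_rels G H"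
      "u \<in> lists (free_product_letters G H)" "v \<in> lists (free_product_letters G H)" for u v
    using that(1) by (auto simp: free_product_rels_def word_eval_def)
  show "free_product_lift K \<phi> \<psi> \<in> hom (free_product G H) K"
    unfolding free_product_lift_def free_product_def
    by (rule presented_lift_hom[OF K.monoid_axioms]) (fact 1 2)+
  have class_eq: "free_product_lift K \<phi> \<psi> (free_product_class G H l) = ?\<chi> l"
    if "l \<in> free_product_letters G H" for l
  proof -
    have "[l] \<in> lists (free_product_letters G H)" using that by auto
    then have "presented_lift K ?\<chi>
        (word_cong (free_product_letters G H) (free_product_rels G H) `` {[l]}) = word_eval K ?\<chi> [l]"
      by (rule presented_lift_class[OF _ K.monoid_axioms]) (fact 1 2)+
    then show ?thesis
      using 1[OF that] by (simp add: free_product_lift_def free_product_class_def word_eval_def)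
  qed
  show "free_product_lift K \<phi> \<psi> (free_product_class G H (Inl a)) = \<phi> a" if "a \<in> carrier G"
    using class_eq[of "Inl a"] that by (auto simp: free_product_letters_def)
  show "free_product_lift K \<phi> \<psi> (free_product_class G H (Inr b)) = \<psi> b" if "b \<in> carrier H"
    using class_eq[of "Inr b"] that by (auto simp: free_product_letters_def)
qed

lemma free_product_hom_eqI:
  assumes "group G" "group H" "group K"
    and "h \<in> hom (free_product G H) K" "k \<in> hom (free_product G H) K"
    and "\<And>a. a \<in> carrier G \<Longrightarrow>
      h (free_product_class G H (Inl a)) = k (free_product_class G H (Inl a))"
    and "\<And>b. b \<in> carrier H \<Longrightarrow>
      h (free_product_class G H (Inr b)) = k (free_product_class G H (Inr b))"
    and "A \<in> carrier (free_product G H)"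
  shows "h A = k A"
  using assms(4,5) group_free_product[OF assms(1,2)] assms(3) _ assms(8)
  unfolding free_product_def
  by (rule presented_hom_eqI)
    (use assms(6,7) in \<open>auto simp: free_product_letters_def free_product_class_def\<close>)

definition polynomial_const ::
    "('a, 'm) monoid_scheme \<Rightarrow> nat \<Rightarrow> 'a \<Rightarrow> ('a + (nat \<times> bool) list set) list set" where
  "polynomial_const G n g = free_product_class G (free_group {1..n}) (Inl g)"

definition polynomial_var ::
    "('a, 'm) monoid_scheme \<Rightarrow> nat \<Rightarrow> nat \<Rightarrow> ('a + (nat \<times> bool) list set) list set" where
  "polynomial_var G n i =
     free_product_class G (free_group {1..n}) (Inr (free_group_gen {1..n} i))"

lemma group_group_polynomials: "group G \<Longrightarrow> group (group_polynomials G n)"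
  unfolding group_polynomials_def by (intro group_free_product group_free_group)

lemma polynomial_const_hom:
  "group G \<Longrightarrow> polynomial_const G n \<in> hom G (group_polynomials G n)"
  using free_product_class_hom(1)[OF _ group_free_group]
  unfolding group_polynomials_def polynomial_const_def by blast

lemma polynomial_var_carrier:
  "i \<in> {1..n} \<Longrightarrow> polynomial_var G n i \<in> carrier (group_polynomials G n)"
  unfolding group_polynomials_def polynomial_var_def
  by (intro free_product_class_carrier)
    (auto simp: free_product_letters_def intro: free_group_gen_carrier)

text \<open>\<open>polynomial_subst G t\<close> is the unique homomorphism that is the identity on \<open>G\<close> and sends
  \<open>x\<^sub>i\<close> to \<open>t\<^sub>i\<close>.\<close>

lemma polynomial_subst:
  assumes "group G" "t \<in> group_power G n"
  shows polynomial_subst_hom: "polynomial_subst G t \<in> hom (group_polynomials G n) G"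
    and polynomial_subst_const: "g \<in> carrier G \<Longrightarrow> polynomial_subst G t (polynomial_const G n g) = g"
    and polynomial_subst_var: "i \<in> {1..n} \<Longrightarrow> polynomial_subst G t (polynomial_var G n i) = t i"
proof -
  have t: "t i \<in> carrier G" if "i \<in> {1..n}" for i
    using assms(2) that by (auto simp: group_power_def)
  have id: "(\<lambda>g. g) \<in> hom G G" by (auto intro: homI)
  note F = free_group_lift_hom[OF assms(1), of "{1..n}" t]
  note P = free_product_lift_hom[OF assms(1) group_free_group assms(1) id F(1)]
  show "polynomial_subst G t \<in> hom (group_polynomials G n) G"
    unfolding polynomial_subst_def group_polynomials_def by (rule P(1)) (rule t)
  show "polynomial_subst G t (polynomial_const G n g) = g" if "g \<in> carrier G"
    unfolding polynomial_subst_def polynomial_const_def by (rule P(2)[OF _ that]) (rule t)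
  show "polynomial_subst G t (polynomial_var G n i) = t i" if "i \<in> {1..n}"
    unfolding polynomial_subst_def polynomial_var_def
    by (subst P(3)) (use t F(2) that in \<open>auto intro!: free_group_gen_carrier\<close>)
qed

lemma polynomial_subst_unique:
  assumes "group G" "t \<in> group_power G n"
    and h: "h \<in> hom (group_polynomials G n) G"
    and "\<And>g. g \<in> carrier G \<Longrightarrow> h (polynomial_const G n g) = g"
    and "\<And>i. i \<in> {1..n} \<Longrightarrow> h (polynomial_var G n i) = t i"
    and f: "f \<in> carrier (group_polynomials G n)"
  shows "h f = polynomial_subst G t f"
proof -
  let ?F = "free_group {1..n}"
  let ?c = "\<lambda>b. free_product_class G ?F (Inr b)"
  note s = polynomial_subst[OF assms(1,2)]
  note c = free_product_class_hom(2)[OF assms(1) group_free_group]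
  have 1: "h (?c b) = polynomial_subst G t (?c b)" if "b \<in> carrier ?F" for b
    using assms(1) _ _ _ that
  proof (rule free_group_hom_eqI)
    show "(\<lambda>b. h (?c b)) \<in> hom ?F G"
      using hom_compose[OF c h[unfolded group_polynomials_def]] by (simp add: comp_def)
    show "(\<lambda>b. polynomial_subst G t (?c b)) \<in> hom ?F G"
      using hom_compose[OF c s(1)[unfolded group_polynomials_def]] by (simp add: comp_def)
  qed (use assms(5) s(3) in \<open>simp add: polynomial_var_def\<close>)
  show ?thesis
    using assms(1) group_free_group assms(1) h[unfolded group_polynomials_def]
      s(1)[unfolded group_polynomials_def] _ 1 f[unfolded group_polynomials_def]
    by (rule free_product_hom_eqI) (use assms(4) s(2) in \<open>simp add: polynomial_const_def\<close>)
qed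

lemma polynomial_function_hom:
  assumes "group G"
  shows "f \<in> carrier (group_polynomials G n) \<Longrightarrow> g \<in> carrier (group_polynomials G n) \<Longrightarrow>
      polynomial_function G n (f \<otimes>\<^bsub>group_polynomials G n\<^esub> g)
      = polynomial_function G n f \<otimes>\<^bsub>polynomial_functions G n\<^esub> polynomial_function G n g"
    and "polynomial_function G n \<one>\<^bsub>group_polynomials G n\<^esub> = \<one>\<^bsub>polynomial_functions G n\<^esub>"
  using hom_mult[OF polynomial_subst_hom[OF assms]]
    hom_one[OF polynomial_subst_hom[OF assms] group_group_polynomials[OF assms] assms]
  by (auto simp: polynomial_function_def polynomial_functions_def fun_eq_iff)

lemma group_polynomial_functions:
  assumes "group G" shows "group (polynomial_functions G n)"
proof -
  let ?P = "group_polynomials G n" and ?Q = "polynomial_functions G n"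
  let ?p = "polynomial_function G n"
  interpret P: group ?P by (rule group_group_polynomials[OF assms])
  note h = polynomial_function_hom[OF assms, where n = n]
  have Q: "carrier ?Q = ?p ` carrier ?P" by (simp add: polynomial_functions_def)
  show ?thesis
  proof (rule groupI)
    fix x assume "x \<in> carrier ?Q"
    then obtain f where f: "f \<in> carrier ?P" "x = ?p f" by (auto simp: Q)
    show "\<one>\<^bsub>?Q\<^esub> \<otimes>\<^bsub>?Q\<^esub> x = x"
      using h(1)[OF P.one_closed f(1)] f by (simp add: h(2))
    show "\<exists>y\<in>carrier ?Q. y \<otimes>\<^bsub>?Q\<^esub> x = \<one>\<^bsub>?Q\<^esub>"
      using h(1)[OF P.inv_closed[OF f(1)] f(1)] f P.inv_closed[OF f(1)] by (auto simp: h(2) Q)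
  next
    show "\<one>\<^bsub>?Q\<^esub> \<in> carrier ?Q" using h(2) by (metis P.one_closed Q imageI)
  next
    fix x y assume "x \<in> carrier ?Q" "y \<in> carrier ?Q"
    then show "x \<otimes>\<^bsub>?Q\<^esub> y \<in> carrier ?Q" by (auto simp: Q simp flip: h(1))
  next
    fix x y z assume "x \<in> carrier ?Q" "y \<in> carrier ?Q" "z \<in> carrier ?Q"
    then show "x \<otimes>\<^bsub>?Q\<^esub> y \<otimes>\<^bsub>?Q\<^esub> z = x \<otimes>\<^bsub>?Q\<^esub> (y \<otimes>\<^bsub>?Q\<^esub> z)"
      by (auto simp: Q P.m_assoc simp flip: h(1))
  qed
qed

end

theory Submission
  imports Defs
begin

text \<open>
  Write \<open>P\<^sub>n\<close> for the group of polynomial functions in \<open>n\<close> variables.  Evaluation at a point maps \<open>P\<^sub>1\<close>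
  onto \<open>G\<close>, so \<open>G\<close> is polycyclic.  The evaluations at the points of \<open>G\<^sup>n\<close> are homomorphisms from \<open>P\<^sub>n\<close> to
  \<open>G\<close> that separate its elements, so \<open>P\<^sub>n\<close> is soluble; and \<open>P\<^sub>n\<close> is generated by the variables and the
  constants from a finite generating set of \<open>G\<close>.  What remains is the maximal condition for
  subgroups, and a finitely generated soluble group can fail it.

  It holds for a finitely generated soluble group that is restrained: for all \<open>f\<close> and \<open>h\<close>, the
  conjugates of \<open>f\<close> by the powers of \<open>h\<close> generate a finitely generated subgroup.  This is an argument
  of Milnor: in a restrained group, the normal part of a finitely generated cyclic extension is
  again finitely generated (\<open>fin_gen_cyclic_extension_imp_fin_gen\<close>).  So the derived subgroup
  is finitely generated, and induction on the derived length yields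
  \<open>restrained_soluble_hereditarily_fin_gen\<close>.

  To see that \<open>P\<^sub>n\<close> is restrained, apply the ascending chain condition in \<open>P\<^sub>1\<close> to the conjugates
  \<open>x\<^sup>i a x\<^sup>-\<^sup>i\<close> of a constant \<open>a\<close>.  Some \<open>x\<^sup>m a x\<^sup>-\<^sup>m\<close> is a word \<open>w\<close> in the preceding conjugates, and
  evaluating this identity of functions shows that \<open>t\<^sup>m a t\<^sup>-\<^sup>m\<close> is the same word \<open>w\<close> in the conjugates
  \<open>t\<^sup>i a t\<^sup>-\<^sup>i\<close> with \<open>i < m\<close>, for all \<open>t \<in> G\<close>.  Such a relation for a single constant says nothing directly
  about a nonconstant \<open>f\<close>, whose values are words of unbounded length in the generators of \<open>G\<close>.
  In an abelian normal section of \<open>G\<close>, however, words are additive, so the elements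
  satisfying the relation for all \<open>t\<close> form a normal subgroup (\<open>normal_recurrence_subgroup\<close>).  Thus
  \<open>G\<close> can be exhausted by normal subgroups, each obtained from the previous one \<open>N\<close> by adjoining
  elements that satisfy a common recurrence modulo \<open>N\<close>, and a function with values in the new one has
  finitely generated orbits because it satisfies the recurrence up to functions with values
  in \<open>N\<close> (\<open>fin_gen_orbit_recurrence\<close>, \<open>restrained_of_separating_homs\<close>).
\<close>

section \<open>Conjugation by powers of an element\<close>

definition conj_pow :: "('a, 'm) monoid_scheme \<Rightarrow> 'a \<Rightarrow> int \<Rightarrow> 'a \<Rightarrow> 'a" where
  "conj_pow K h i f = h [^]\<^bsub>K\<^esub> i \<otimes>\<^bsub>K\<^esub> f \<otimes>\<^bsub>K\<^esub> inv\<^bsub>K\<^esub> (h [^]\<^bsub>K\<^esub> i)"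

context group
begin

lemma conj_pow_closed [simp, intro]:
  "h \<in> carrier G \<Longrightarrow> f \<in> carrier G \<Longrightarrow> conj_pow G h i f \<in> carrier G"
  by (simp add: conj_pow_def)

lemma conj_pow_mult:
  assumes "h \<in> carrier G" "f \<in> carrier G" "g \<in> carrier G"
  shows "conj_pow G h i (f \<otimes> g) = conj_pow G h i f \<otimes> conj_pow G h i g"
proof -
  have "inv (h [^] i) \<otimes> (h [^] i \<otimes> (g \<otimes> inv (h [^] i))) = g \<otimes> inv (h [^] i)"
    using assms by (simp flip: m_assoc)
  then show ?thesis using assms by (simp add: conj_pow_def m_assoc)
qed

lemma group_hom_conj_pow: "h \<in> carrier G \<Longrightarrow> group_hom G G (conj_pow G h i)"
  by unfold_locales (auto simp: hom_def conj_pow_mult)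

lemma conj_pow_inv:
  assumes "h \<in> carrier G" "f \<in> carrier G"
  shows "conj_pow G h i (inv f) = inv (conj_pow G h i f)"
  using group_hom.hom_inv[OF group_hom_conj_pow] assms by blast

lemma conj_pow_one: "h \<in> carrier G \<Longrightarrow> conj_pow G h i \<one> = \<one>"
  using group_hom.hom_one[OF group_hom_conj_pow] by blast

lemma conj_pow_0 [simp]: "f \<in> carrier G \<Longrightarrow> conj_pow G h 0 f = f"
  by (simp add: conj_pow_def)

lemma conj_pow_add:
  assumes "h \<in> carrier G" "f \<in> carrier G"
  shows "conj_pow G h i (conj_pow G h j f) = conj_pow G h (i + j) f"
  using assms by (simp add: conj_pow_def m_assoc inv_mult_group int_pow_mult)

lemma conj_pow_inv_base:
  "h \<in> carrier G \<Longrightarrow> conj_pow G (inv h) i f = conj_pow G h (- i) f"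
  by (simp add: conj_pow_def int_pow_inv int_pow_neg)

lemma int_pow_mult_eq_conj_pow:
  assumes "h \<in> carrier G" "f \<in> carrier G"
  shows "h [^] (i::int) \<otimes> f = conj_pow G h i f \<otimes> h [^] i"
  using assms by (simp add: conj_pow_def m_assoc)

lemma conj_pow_generate:
  assumes "h \<in> carrier G" "Y \<subseteq> carrier G" "subgroup L G"
    and "\<And>y. y \<in> Y \<Longrightarrow> conj_pow G h i y \<in> L"
    and "x \<in> generate G Y"
  shows "conj_pow G h i x \<in> L"
  using assms(5)
proof (induction x rule: generate.induct)
  case (eng x y)
  then show ?case
    using assms by (simp add: conj_pow_mult generate_in_carrier subgroup.m_closed)
next
  case (inv y)
  then have "y \<in> carrier G" using assms(2) by blast
  then show ?case
    using assms inv by (simp add: conj_pow_inv subgroup.m_inv_closed)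
qed (use assms in \<open>auto simp: conj_pow_one subgroup.one_closed\<close>)

end

lemma (in group_hom) hom_conj_pow:
  assumes "t \<in> carrier G" "a \<in> carrier G"
  shows "h (conj_pow G t i a) = conj_pow H (h t) i (h a)"
  using assms by (simp add: conj_pow_def hom_int_pow)

section \<open>Finitely generated subgroups and the maximal condition\<close>

definition fin_gen :: "('a, 'm) monoid_scheme \<Rightarrow> 'a set \<Rightarrow> bool" where
  "fin_gen K H \<longleftrightarrow> (\<exists>F. finite F \<and> F \<subseteq> carrier K \<and> generate K F = H)"

definition hereditarily_fin_gen :: "('a, 'm) monoid_scheme \<Rightarrow> 'a set \<Rightarrow> bool" where
  "hereditarily_fin_gen K H \<longleftrightarrow> (\<forall>S. subgroup S K \<and> S \<subseteq> H \<longrightarrow> fin_gen K S)"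

context group
begin

lemma fin_genI:
  assumes "finite F" "F \<subseteq> S" "subgroup S G" "S \<subseteq> generate G F"
  shows "fin_gen G S"
  unfolding fin_gen_def
  using assms generate_subgroup_incl[OF assms(2,3)] subgroup.subset[OF assms(3)] by blast

text \<open>The union of a chain of subgroups that is finitely generated is attained by a member of
  the chain, so that Zorn's lemma applies to every family of subgroups.\<close>

lemma hereditarily_fin_gen_imp_noetherian:
  assumes "hereditarily_fin_gen G (carrier G)"
  shows "noetherian_group G"
  unfolding noetherian_group_def
proof (intro conjI allI impI)
  show "group G" by (rule is_group)
  fix S :: "'a set set" assume S: "S \<noteq> {} \<and> (\<forall>H\<in>S. subgroup H G)"
  show "\<exists>M\<in>S. \<forall>H\<in>S. M \<subseteq> H \<longrightarrow> H = M"
  proof (rule subset_Zorn_nonempty)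
    show "S \<noteq> {}" using S by blast
    fix C assume C: "C \<noteq> {}" "subset.chain S C"
    then have sub: "subgroup H G" if "H \<in> C" for H
      using S that by (auto simp: subset.chain_def)
    have "subgroup (\<Union>C) G"
    proof (rule subgroupI)
      show "\<Union>C \<subseteq> carrier G" using subgroup.subset[OF sub] by blast
      show "\<Union>C \<noteq> {}" using subgroup.one_closed[OF sub] C(1) by blast
      show "inv a \<in> \<Union>C" if "a \<in> \<Union>C" for a
        using that subgroup.m_inv_closed[OF sub] by blast
      show "a \<otimes> b \<in> \<Union>C" if ab: "a \<in> \<Union>C" "b \<in> \<Union>C" for a b
      proof -
        obtain H where "H \<in> C" "{a, b} \<subseteq> H"
          by (rule finite_subset_Union_chain[of "{a, b}" C S]) (use ab C in auto)
        then show ?thesis using subgroup.m_closed[OF sub] by blast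
      qed
    qed
    moreover from this have "\<Union>C \<subseteq> carrier G" by (rule subgroup.subset)
    ultimately have "fin_gen G (\<Union>C)"
      using assms unfolding hereditarily_fin_gen_def by simp
    then obtain F where F: "finite F" "F \<subseteq> carrier G" "generate G F = \<Union>C"
      unfolding fin_gen_def by auto
    have "F \<subseteq> \<Union>C" unfolding F(3)[symmetric] by (rule subsetI) (rule generate.incl)
    then obtain H where H: "H \<in> C" "F \<subseteq> H"
      by (rule finite_subset_Union_chain[OF F(1) _ C])
    have "\<Union>C \<subseteq> H" using generate_subgroup_incl[OF H(2) sub[OF H(1)]] F(3) by simp
    then have "\<Union>C = H" using H(1) by blast
    then show "\<Union>C \<in> S" using C(2) H(1) by (auto simp: subset.chain_def)
  qed
qed

lemma noetherian_sequence_generate: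
  fixes u :: "nat \<Rightarrow> 'a"
  assumes "noetherian_group G" "\<And>i. u i \<in> carrier G"
  shows "\<exists>k. \<forall>j. u j \<in> generate G (u ` {..<k})"
proof -
  let ?S = "range (\<lambda>k. generate G (u ` {..<k}))"
  have "\<forall>H\<in>?S. subgroup H G" using assms(2) by (auto intro!: generate_is_subgroup)
  then obtain M where M: "M \<in> ?S" "\<forall>H\<in>?S. M \<subseteq> H \<longrightarrow> H = M"
    using assms(1) unfolding noetherian_group_def by (metis empty_not_insert image_is_empty UNIV_not_empty)
  then obtain k where k: "M = generate G (u ` {..<k})" by blast
  have "u j \<in> M" for j
  proof -
    have "M \<subseteq> generate G (u ` {..<max k (Suc j)})"
      unfolding k by (intro mono_generate image_mono) auto
    then have "generate G (u ` {..<max k (Suc j)}) = M" using M(2) by blast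
    moreover have "u j \<in> generate G (u ` {..<max k (Suc j)})" by (intro generate.incl) auto
    ultimately show ?thesis by blast
  qed
  then show ?thesis using k by blast
qed

lemma noetherian_imp_fin_gen:
  assumes "noetherian_group G"
  shows "fin_gen G (carrier G)"
proof -
  let ?S = "generate G ` {F. finite F \<and> F \<subseteq> carrier G}"
  have "generate G {} \<in> ?S" by blast
  then have "?S \<noteq> {}" by blast
  moreover have "\<forall>H\<in>?S. subgroup H G" by (auto intro!: generate_is_subgroup)
  ultimately obtain M where M: "M \<in> ?S" "\<forall>H\<in>?S. M \<subseteq> H \<longrightarrow> H = M"
    using assms unfolding noetherian_group_def by meson
  then obtain F where F: "finite F" "F \<subseteq> carrier G" "M = generate G F" by blast
  have "x \<in> M" if "x \<in> carrier G" for x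
  proof -
    have "generate G (insert x F) = M"
    proof -
      have "generate G (insert x F) \<in> ?S" using F that by blast
      moreover have "M \<subseteq> generate G (insert x F)" unfolding F(3) by (intro mono_generate) blast
      ultimately show ?thesis using M(2) by blast
    qed
    then show ?thesis using generate.incl[of x "insert x F" G] by simp
  qed
  then show ?thesis using F generate_incl[OF F(2)] unfolding fin_gen_def by blast
qed

end

lemma (in group_hom) noetherian_image:
  assumes "noetherian_group G" "h ` carrier G = carrier H"
  shows "noetherian_group H"
  unfolding noetherian_group_def
proof (intro conjI allI impI)
  show "group H" by (rule H.is_group)
  fix S assume S: "S \<noteq> {} \<and> (\<forall>K\<in>S. subgroup K H)"
  let ?p = "\<lambda>K. {x \<in> carrier G. h x \<in> K}"
  have sub: "subgroup (?p K) G" if "subgroup K H" for K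
  proof (rule G.subgroupI)
    have "\<one> \<in> ?p K" using subgroup.one_closed[OF that] by simp
    then show "?p K \<noteq> {}" by blast
  qed (use that in \<open>auto simp: subgroup.m_closed subgroup.m_inv_closed\<close>)
  have "?p ` S \<noteq> {}" "\<forall>K\<in>?p ` S. subgroup K G" using S sub by auto
  then obtain M where M: "M \<in> ?p ` S" "\<forall>K\<in>?p ` S. M \<subseteq> K \<longrightarrow> K = M"
    using assms(1) unfolding noetherian_group_def by meson
  then obtain K where K: "K \<in> S" "M = ?p K" by blast
  have im: "h ` ?p L = L" if "L \<in> S" for L
  proof -
    have "L \<subseteq> carrier H" using S that subgroup.subset by blast
    then have "\<exists>x\<in>carrier G. h x = y" if "y \<in> L" for y
      using that assms(2) by (metis imageE subsetD)
    then show ?thesis by blast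
  qed
  have "L = K" if L: "L \<in> S" "K \<subseteq> L" for L
  proof -
    have "M \<subseteq> ?p L" using K(2) L(2) by blast
    then have "?p L = ?p K" using M(2) L(1) K(2) by blast
    then show ?thesis using im[OF L(1)] im[OF K(1)] by metis
  qed
  then show "\<exists>M\<in>S. \<forall>K\<in>S. M \<subseteq> K \<longrightarrow> K = M" using K(1) by blast
qed

section \<open>Cyclic extensions\<close>

lemma int_subgroup_multiples:
  fixes Z :: "int set"
  assumes "0 \<in> Z" "\<And>x y. x \<in> Z \<Longrightarrow> y \<in> Z \<Longrightarrow> x - y \<in> Z"
  shows "\<exists>e\<in>Z. \<forall>z\<in>Z. e dvd z"
proof (cases "Z = {0}")
  case True
  then show ?thesis by auto
next
  case False
  have neg: "- x \<in> Z" if "x \<in> Z" for x using assms(2)[OF assms(1) that] by simp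
  have add: "x + y \<in> Z" if "x \<in> Z" "y \<in> Z" for x y using assms(2)[OF that(1) neg[OF that(2)]] by simp
  have mul_nat: "x * int n \<in> Z" if "x \<in> Z" for x n
    by (induction n) (use that assms(1) add in \<open>auto simp: algebra_simps\<close>)
  have mul: "x * k \<in> Z" if "x \<in> Z" for x k
    using mul_nat[OF that, of "nat k"] neg[OF mul_nat[OF that, of "nat (- k)"]]
    by (cases "k \<ge> 0") auto
  obtain y where y: "y \<in> Z" "y \<noteq> 0" using False assms(1) by blast
  define n where "n = (LEAST n. n > 0 \<and> int n \<in> Z)"
  have "nat \<bar>y\<bar> > 0 \<and> int (nat \<bar>y\<bar>) \<in> Z" using y neg by (auto simp: abs_if)
  then have n: "n > 0 \<and> int n \<in> Z" unfolding n_def by (rule LeastI)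
  have least: "n \<le> m" if "m > 0 \<and> int m \<in> Z" for m
    unfolding n_def by (rule Least_le[of _ m]) (rule that)
  have "int n dvd z" if z: "z \<in> Z" for z
  proof -
    have r: "z mod int n \<in> Z"
      using assms(2)[OF z mul[of "int n" "z div int n"]] n by (simp add: minus_mult_div_eq_mod)
    have "0 \<le> z mod int n" "z mod int n < int n" using n by auto
    moreover have "\<not> nat (z mod int n) > 0"
    proof
      assume "nat (z mod int n) > 0"
      then have "n \<le> nat (z mod int n)" using least r \<open>0 \<le> z mod int n\<close> by simp
      then have "int n \<le> z mod int n" using \<open>0 \<le> z mod int n\<close> by simp
      then show False using \<open>z mod int n < int n\<close> by simp
    qed
    ultimately have "z mod int n = 0" by linarith
    then show ?thesis by (simp add: dvd_eq_mod_eq_0)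
  qed
  then show ?thesis using n by blast
qed

context group
begin

lemma generate_insert_normalized:
  assumes K: "subgroup K G" and a: "a \<in> carrier G"
    and inv: "\<And>i x. x \<in> K \<Longrightarrow> conj_pow G a i x \<in> K"
  shows "generate G (insert a K) = {x \<otimes> a [^] z | x z. x \<in> K \<and> z \<in> (UNIV::int set)}" (is "_ = ?R")
proof
  have Kc: "x \<in> carrier G" if "x \<in> K" for x using subgroup.mem_carrier[OF K that] .
  have sub: "subgroup ?R G"
  proof (rule subgroupI)
    show "?R \<subseteq> carrier G" using Kc a by auto
    show "?R \<noteq> {}" using subgroup.one_closed[OF K] by blast
    fix s assume "s \<in> ?R"
    then obtain x z where s: "s = x \<otimes> a [^] (z::int)" "x \<in> K" by blast
    have "inv s = conj_pow G a (- z) (inv x) \<otimes> a [^] (- z)"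
      using s Kc a int_pow_mult_eq_conj_pow[of a "inv x" "- z"]
      by (simp add: inv_mult_group int_pow_neg)
    moreover have "conj_pow G a (- z) (inv x) \<in> K" using inv subgroup.m_inv_closed[OF K s(2)] by blast
    ultimately show "inv s \<in> ?R" by blast
    fix t assume "t \<in> ?R"
    then obtain y w where t: "t = y \<otimes> a [^] (w::int)" "y \<in> K" by blast
    have "s \<otimes> t = x \<otimes> (a [^] z \<otimes> y) \<otimes> a [^] w" using s t Kc a by (simp add: m_assoc)
    also have "\<dots> = (x \<otimes> conj_pow G a z y) \<otimes> a [^] (z + w)"
      using s t Kc a int_pow_mult_eq_conj_pow[of a y z]
      by (simp add: m_assoc int_pow_mult)
    finally show "s \<otimes> t \<in> ?R" using inv[OF t(2)] subgroup.m_closed[OF K s(2)] by blast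
  qed
  have "insert a K \<subseteq> ?R"
  proof
    fix x assume "x \<in> insert a K"
    then show "x \<in> ?R"
    proof
      assume "x = a"
      then have "x = \<one> \<otimes> a [^] (1::int)" using a by simp
      then show ?thesis using subgroup.one_closed[OF K] by blast
    next
      assume x: "x \<in> K"
      then have "x = x \<otimes> a [^] (0::int)" using Kc by simp
      then show ?thesis using x by blast
    qed
  qed
  then show "generate G (insert a K) \<subseteq> ?R" by (rule generate_subgroup_incl[OF _ sub])
  have g: "subgroup (generate G (insert a K)) G" using a Kc by (intro generate_is_subgroup) auto
  show "?R \<subseteq> generate G (insert a K)"
  proof
    fix s assume "s \<in> ?R"
    then obtain x z where s: "s = x \<otimes> a [^] (z::int)" "x \<in> K" by blast
    then show "s \<in> generate G (insert a K)"
      using subgroup.m_closed[OF g generate.incl[of x] subgroup_int_pow_closed[OF g generate.incl[of a]]]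
      by blast
  qed
qed

text \<open>Modulo the normal part, a subgroup of a cyclic extension is a subgroup of a cyclic group,
  hence generated by one further element.\<close>

lemma hereditarily_fin_gen_cyclic_extension:
  assumes K: "subgroup K G" and a: "a \<in> carrier G"
    and inv: "\<And>i x. x \<in> K \<Longrightarrow> conj_pow G a i x \<in> K"
    and her: "hereditarily_fin_gen G K"
  shows "hereditarily_fin_gen G (generate G (insert a K))"
  unfolding hereditarily_fin_gen_def
proof (intro allI impI, elim conjE)
  fix S assume S: "subgroup S G" "S \<subseteq> generate G (insert a K)"
  have Kc: "x \<in> carrier G" if "x \<in> K" for x using subgroup.mem_carrier[OF K that] .
  have form: "\<exists>x\<in>K. \<exists>z::int. s = x \<otimes> a [^] z" if "s \<in> S" for s
  proof -
    have "generate G (insert a K) = {x \<otimes> a [^] z | x z. x \<in> K \<and> z \<in> (UNIV::int set)}"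
      by (rule generate_insert_normalized[OF K a]) (rule inv)
    then show ?thesis using S(2) that by blast
  qed
  \<comment> \<open>The exponents of \<open>a\<close> that occur in \<open>S\<close>; below, \<open>e\<close> generates this group of integers.\<close>
  define Z where "Z = {z::int. \<exists>x\<in>K. x \<otimes> a [^] z \<in> S}"
  have quot: "\<exists>y\<in>K. (x \<otimes> a [^] z) \<otimes> inv (x' \<otimes> a [^] w) = y \<otimes> a [^] (z - w)"
    if "x \<in> K" "x' \<in> K" for x x' and z w :: int
  proof -
    have "(x \<otimes> a [^] z) \<otimes> inv (x' \<otimes> a [^] w) = x \<otimes> (a [^] (z - w) \<otimes> inv x')"
      using that Kc a by (simp add: inv_mult_group m_assoc int_pow_diff)
    also have "\<dots> = (x \<otimes> conj_pow G a (z - w) (inv x')) \<otimes> a [^] (z - w)"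
      using that Kc a int_pow_mult_eq_conj_pow[of a "inv x'" "z - w"] by (simp add: m_assoc)
    finally show ?thesis
      using inv[OF subgroup.m_inv_closed[OF K that(2)]] subgroup.m_closed[OF K that(1)] by blast
  qed
  have "\<exists>e\<in>Z. \<forall>z\<in>Z. e dvd z"
  proof (rule int_subgroup_multiples)
    show "0 \<in> Z" unfolding Z_def
      using subgroup.one_closed[OF K] subgroup.one_closed[OF S(1)] by (auto intro!: bexI[of _ \<one>])
    fix z w assume "z \<in> Z" "w \<in> Z"
    then obtain x x' where x: "x \<in> K" "x \<otimes> a [^] z \<in> S" "x' \<in> K" "x' \<otimes> a [^] w \<in> S"
      unfolding Z_def by blast
    obtain y where "y \<in> K" "(x \<otimes> a [^] z) \<otimes> inv (x' \<otimes> a [^] w) = y \<otimes> a [^] (z - w)"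
      using quot x by blast
    then show "z - w \<in> Z" unfolding Z_def
      using subgroup.m_closed[OF S(1) x(2) subgroup.m_inv_closed[OF S(1) x(4)]] by auto
  qed
  then obtain e x0 where e: "\<And>z. z \<in> Z \<Longrightarrow> e dvd z" and x0: "x0 \<in> K" "x0 \<otimes> a [^] e \<in> S"
    unfolding Z_def by blast
  define s0 where "s0 = x0 \<otimes> a [^] e"
  have s0: "s0 \<in> S" "s0 \<in> carrier G" using x0 subgroup.mem_carrier[OF S(1)] by (auto simp: s0_def)
  have pow: "\<exists>y\<in>K. s0 [^] (q::int) = y \<otimes> a [^] (e * q)" for q
  proof -
    have nat: "\<exists>y\<in>K. s0 [^] (int n) = y \<otimes> a [^] (e * int n)" for n
    proof (induction n)
      case 0
      then show ?case using subgroup.one_closed[OF K] by (auto intro!: bexI[of _ \<one>])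
    next
      case (Suc n)
      then obtain y where y: "y \<in> K" "s0 [^] (int n) = y \<otimes> a [^] (e * int n)" by blast
      have "s0 [^] (int (Suc n)) = s0 [^] (int n) \<otimes> s0"
        using s0 by (simp add: int_pow_int del: of_nat_Suc)
      also have "\<dots> = y \<otimes> (a [^] (e * int n) \<otimes> x0) \<otimes> a [^] e"
        using y x0 Kc a by (simp add: s0_def m_assoc)
      also have "\<dots> = (y \<otimes> conj_pow G a (e * int n) x0) \<otimes> a [^] (e * int n + e)"
        using y x0 Kc a int_pow_mult_eq_conj_pow[of a x0 "e * int n"] by (simp add: m_assoc int_pow_mult)
      finally show ?case
        using inv[OF x0(1)] subgroup.m_closed[OF K y(1)] by (auto simp: algebra_simps)
    qed
    show ?thesis
    proof (cases "q \<ge> 0")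
      case True
      then show ?thesis using nat[of "nat q"] by simp
    next
      case False
      obtain y where y: "y \<in> K" "s0 [^] (- q) = y \<otimes> a [^] (e * - q)"
        using nat[of "nat (- q)"] False by auto
      obtain y' where y': "y' \<in> K"
        "(\<one> \<otimes> a [^] (0::int)) \<otimes> inv (y \<otimes> a [^] (e * - q)) = y' \<otimes> a [^] (0 - e * - q)"
        using quot[OF subgroup.one_closed[OF K] y(1)] by blast
      have "s0 [^] q = inv (s0 [^] (- q))" using s0 by (simp add: int_pow_neg)
      also have "\<dots> = y' \<otimes> a [^] (e * q)" using y'(2) y Kc a by simp
      finally show ?thesis using y'(1) by blast
    qed
  qed
  have "subgroup (S \<inter> K) G" by (rule subgroups_Inter_pair[OF S(1) K])
  then obtain F where F: "finite F" "F \<subseteq> carrier G" "generate G F = S \<inter> K"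
    using her unfolding hereditarily_fin_gen_def fin_gen_def by blast
  show "fin_gen G S"
  proof (rule fin_genI[OF _ _ S(1), where F = "insert s0 F"])
    show "finite (insert s0 F)" using F(1) by simp
    have "F \<subseteq> S \<inter> K" unfolding F(3)[symmetric] by (rule subsetI) (rule generate.incl)
    then show FS: "insert s0 F \<subseteq> S" using s0 by simp
    have sub: "subgroup (generate G (insert s0 F)) G" using s0 F(2) by (intro generate_is_subgroup) auto
    show "S \<subseteq> generate G (insert s0 F)"
    proof
      fix s assume s: "s \<in> S"
      then obtain x z where x: "x \<in> K" "s = x \<otimes> a [^] (z::int)" using form by blast
      then obtain q where q: "z = e * q" using e s by (auto simp: Z_def elim!: dvdE)
      obtain y where y: "y \<in> K" "s0 [^] q = y \<otimes> a [^] (e * q)" using pow by blast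
      have "s \<otimes> inv (s0 [^] q) = x \<otimes> inv y"
      proof -
        have "s \<otimes> inv (s0 [^] q) = (x \<otimes> (a [^] z \<otimes> inv (a [^] z))) \<otimes> inv y"
          using x(1) y(1) Kc a unfolding x(2) y(2) q by (simp only: inv_mult_group m_assoc
            int_pow_closed inv_closed m_closed)
        then show ?thesis using x(1) y(1) Kc a by simp
      qed
      then have "s \<otimes> inv (s0 [^] q) \<in> S \<inter> K"
        using subgroup.m_closed[OF K x(1) subgroup.m_inv_closed[OF K y(1)]]
          subgroup.m_closed[OF S(1) s subgroup.m_inv_closed[OF S(1) subgroup_int_pow_closed[OF S(1) s0(1)]]]
        by (metis IntI)
      then have "s \<otimes> inv (s0 [^] q) \<in> generate G (insert s0 F)"
        using F(3) mono_generate[of F "insert s0 F"] by blast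
      moreover have "s0 [^] q \<in> generate G (insert s0 F)"
        by (intro subgroup_int_pow_closed[OF sub] generate.incl) simp
      ultimately have "s \<otimes> inv (s0 [^] q) \<otimes> s0 [^] q \<in> generate G (insert s0 F)"
        by (rule generate.eng)
      then show "s \<in> generate G (insert s0 F)"
        using s s0 subgroup.mem_carrier[OF S(1)] by (simp add: m_assoc)
    qed
  qed
qed

end

section \<open>Restrained soluble groups\<close>

text \<open>Only conjugation by nonnegative powers of \<open>h\<close> is considered, because that is what the
  recurrences obtained later control; in a restrained group negative powers are covered by
  replacing \<open>h\<close> by its inverse.\<close>

definition fin_gen_orbit :: "('a, 'm) monoid_scheme \<Rightarrow> 'a \<Rightarrow> 'a \<Rightarrow> bool" where
  "fin_gen_orbit K h f \<longleftrightarrow>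
     (\<exists>k. \<forall>j. conj_pow K h (int j) f \<in> generate K ((\<lambda>i. conj_pow K h (int i) f) ` {..<k::nat}))"

definition restrained :: "('a, 'm) monoid_scheme \<Rightarrow> bool" where
  "restrained K \<longleftrightarrow> (\<forall>f\<in>carrier K. \<forall>h\<in>carrier K. fin_gen_orbit K h f)"

context group
begin

lemma restrained_full_orbit:
  assumes "restrained G" "f \<in> carrier G" "h \<in> carrier G"
  shows "\<exists>I. finite I \<and> (\<forall>z. conj_pow G h z f \<in> generate G ((\<lambda>i. conj_pow G h i f) ` I))"
proof -
  obtain k where k: "\<And>j. conj_pow G h (int j) f \<in> generate G ((\<lambda>i. conj_pow G h (int i) f) ` {..<k::nat})"
    using assms unfolding restrained_def fin_gen_orbit_def by blast
  have "fin_gen_orbit G (inv h) f" using assms unfolding restrained_def by simp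
  then obtain l where l: "\<And>j. conj_pow G h (- int j) f \<in> generate G ((\<lambda>i. conj_pow G h (- int i) f) ` {..<l::nat})"
    using assms(3) by (auto simp: fin_gen_orbit_def conj_pow_inv_base)
  define I where "I = int ` {..<k} \<union> (\<lambda>i. - int i) ` {..<l}"
  have "conj_pow G h z f \<in> generate G ((\<lambda>i. conj_pow G h i f) ` I)" for z
  proof (cases "z \<ge> 0")
    case True
    have "(\<lambda>i. conj_pow G h (int i) f) ` {..<k} \<subseteq> (\<lambda>i. conj_pow G h i f) ` I"
      by (auto simp: I_def)
    from mono_generate[OF this] show ?thesis using k[of "nat z"] True by auto
  next
    case False
    have "(\<lambda>i. conj_pow G h (- int i) f) ` {..<l} \<subseteq> (\<lambda>i. conj_pow G h i f) ` I"
      by (auto simp: I_def)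
    from mono_generate[OF this] show ?thesis using l[of "nat (- z)"] False by auto
  qed
  moreover have "finite I" by (simp add: I_def)
  ultimately show ?thesis by blast
qed

text \<open>Milnor's argument: write the generators of the extension as \<open>x a\<^sup>z\<close> with \<open>x\<close> in the normal
  part.  By restrainedness the \<open>\<langle>a\<rangle>\<close>-conjugates of the finitely many \<open>x\<close> generate a finitely
  generated group \<open>L\<close>, which is normalized by \<open>a\<close>; so the extension is \<open>L\<langle>a\<rangle>\<close>, and the normal part
  exceeds \<open>L\<close> at most by a cyclic group of powers of \<open>a\<close>.\<close>

lemma fin_gen_cyclic_extension_imp_fin_gen:
  assumes res: "restrained G"
    and K: "subgroup K G" and a: "a \<in> carrier G"
    and inv: "\<And>i x. x \<in> K \<Longrightarrow> conj_pow G a i x \<in> K"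
    and fg: "fin_gen G (generate G (insert a K))"
  shows "fin_gen G K"
proof -
  have Kc: "x \<in> carrier G" if "x \<in> K" for x using subgroup.mem_carrier[OF K that] .
  obtain F where F: "finite F" "F \<subseteq> carrier G" "generate G F = generate G (insert a K)"
    using fg unfolding fin_gen_def by blast
  have gen_eq: "generate G (insert a K) = {x \<otimes> a [^] z | x z. x \<in> K \<and> z \<in> (UNIV::int set)}"
    by (rule generate_insert_normalized[OF K a]) (rule inv)
  have "F \<subseteq> generate G F" by (rule subsetI) (rule generate.incl)
  then have "\<forall>f\<in>F. \<exists>x. x \<in> K \<and> (\<exists>z::int. f = x \<otimes> a [^] z)" using F(3) gen_eq by blast
  from bchoice[OF this] obtain \<xi> where \<xi>: "\<And>f. f \<in> F \<Longrightarrow> \<xi> f \<in> K"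
    "\<And>f. f \<in> F \<Longrightarrow> \<exists>z::int. f = \<xi> f \<otimes> a [^] z" by blast
  have "\<forall>x\<in>carrier G. \<exists>I. finite I \<and> (\<forall>z. conj_pow G a z x \<in> generate G ((\<lambda>i. conj_pow G a i x) ` I))"
    using restrained_full_orbit[OF res _ a] by blast
  from bchoice[OF this] obtain I where I: "\<And>x. x \<in> carrier G \<Longrightarrow> finite (I x)"
    "\<And>x z. x \<in> carrier G \<Longrightarrow> conj_pow G a z x \<in> generate G ((\<lambda>i. conj_pow G a i x) ` I x)" by blast
  \<comment> \<open>\<open>\<xi> f\<close> is the normal part of the generator \<open>f\<close>; the conjugates of it with exponents in
    \<open>I (\<xi> f)\<close> already generate all its conjugates by powers of \<open>a\<close>.\<close>
  define Y where "Y = (\<Union>f\<in>F. (\<lambda>i. conj_pow G a i (\<xi> f)) ` I (\<xi> f))"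
  have Y: "finite Y" "Y \<subseteq> K" using F(1) I(1) \<xi>(1) Kc inv by (auto simp: Y_def)
  have Yc: "Y \<subseteq> carrier G" using Y(2) Kc by blast
  define L where "L = generate G Y"
  have L: "subgroup L G" unfolding L_def by (rule generate_is_subgroup[OF Yc])
  have LK: "L \<subseteq> K" unfolding L_def by (rule generate_subgroup_incl[OF Y(2) K])
  have orbit: "conj_pow G a z (\<xi> f) \<in> L" if "f \<in> F" for f z
  proof -
    have "(\<lambda>i. conj_pow G a i (\<xi> f)) ` I (\<xi> f) \<subseteq> Y" using that by (auto simp: Y_def)
    from mono_generate[OF this] show ?thesis
      using I(2)[OF Kc[OF \<xi>(1)[OF that]]] unfolding L_def by blast
  qed
  have Linv: "conj_pow G a i x \<in> L" if "x \<in> L" for i x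
  proof (rule conj_pow_generate[OF a Yc L])
    show "x \<in> generate G Y" using that by (simp add: L_def)
    fix y assume "y \<in> Y"
    then obtain f j where "f \<in> F" "y = conj_pow G a j (\<xi> f)" by (auto simp: Y_def)
    then show "conj_pow G a i y \<in> L" using orbit \<xi>(1) Kc a by (simp add: conj_pow_add)
  qed
  have genL: "generate G (insert a L) = {x \<otimes> a [^] z | x z. x \<in> L \<and> z \<in> (UNIV::int set)}"
    by (rule generate_insert_normalized[OF L a]) (rule Linv)
  have "F \<subseteq> generate G (insert a L)"
  proof
    fix f assume f: "f \<in> F"
    then have "\<xi> f \<in> L" using orbit[OF f, of 0] \<xi>(1)[OF f] Kc by simp
    then show "f \<in> generate G (insert a L)" unfolding genL using \<xi>(2)[OF f] by blast
  qed
  moreover have "subgroup (generate G (insert a L)) G"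
    using a subgroup.subset[OF L] by (intro generate_is_subgroup) auto
  ultimately have "generate G F \<subseteq> generate G (insert a L)" by (rule generate_subgroup_incl)
  moreover have "K \<subseteq> generate G (insert a K)" by (auto intro: generate.incl)
  ultimately have form: "\<exists>x\<in>L. \<exists>z::int. y = x \<otimes> a [^] z" if "y \<in> K" for y
    using that genL F(3) by blast
  define Z where "Z = {z::int. a [^] z \<in> K}"
  have "\<exists>e\<in>Z. \<forall>z\<in>Z. e dvd z"
    by (rule int_subgroup_multiples)
      (use K a in \<open>auto simp: Z_def int_pow_diff subgroup.one_closed subgroup.m_closed subgroup.m_inv_closed\<close>)
  then obtain e :: int where e: "a [^] e \<in> K" "\<And>z::int. a [^] z \<in> K \<Longrightarrow> e dvd z" by (auto simp: Z_def)
  show ?thesis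
  proof (rule fin_genI[OF _ _ K, where F = "insert (a [^] e) Y"])
    show "finite (insert (a [^] e) Y)" "insert (a [^] e) Y \<subseteq> K" using Y e(1) by auto
    have sub: "subgroup (generate G (insert (a [^] e) Y)) G"
      using Yc a by (intro generate_is_subgroup) auto
    show "K \<subseteq> generate G (insert (a [^] e) Y)"
    proof
      fix y assume y: "y \<in> K"
      then obtain x z where x: "x \<in> L" "y = x \<otimes> a [^] (z::int)" using form by blast
      then have xK: "x \<in> K" using LK by blast
      have "a [^] z = inv x \<otimes> y" using x xK Kc a by (simp flip: m_assoc)
      then have "a [^] z \<in> K" using subgroup.m_closed[OF K subgroup.m_inv_closed[OF K xK] y] by simp
      then obtain q where "z = e * q" using e(2) by (blast elim: dvdE)
      then have "a [^] z = (a [^] e) [^] q" using a by (simp add: int_pow_pow)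
      moreover have "(a [^] e) [^] q \<in> generate G (insert (a [^] e) Y)"
        by (intro subgroup_int_pow_closed[OF sub] generate.incl) simp
      moreover have "x \<in> generate G (insert (a [^] e) Y)"
        using x(1) mono_generate[of Y "insert (a [^] e) Y"] unfolding L_def by blast
      ultimately show "y \<in> generate G (insert (a [^] e) Y)" unfolding x(2) by (simp add: generate.eng)
    qed
  qed
qed

text \<open>This is what makes every \<open>K\<close> between \<open>H'\<close> and \<open>H\<close> the normal part of a cyclic extension
  inside \<open>H\<close>.\<close>

lemma conj_pow_mem_of_derived_subset:
  assumes H: "subgroup H G" and K: "subgroup K G" "derived G H \<subseteq> K" "K \<subseteq> H"
    and a: "a \<in> H" and x: "x \<in> K"
  shows "conj_pow G a i x \<in> K"
proof -
  have c: "a \<in> carrier G" "x \<in> carrier G"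
    using a x subgroup.mem_carrier[OF H] subgroup.mem_carrier[OF K(1)] by auto
  have "a [^] i \<otimes> x \<otimes> inv (a [^] i) \<otimes> inv x \<in> derived_set G H"
    using subgroup_int_pow_closed[OF H a, of i] x K(3) by blast
  then have "conj_pow G a i x \<otimes> inv x \<in> K"
    using K(2) unfolding derived_def conj_pow_def by (blast intro: generate.incl)
  from subgroup.m_closed[OF K(1) this x] show ?thesis using c by (simp add: m_assoc)
qed

text \<open>Climbing from \<open>K \<supseteq> H'\<close> to \<open>H\<close> by cyclic extensions, finite generation passes down from \<open>H\<close> to
  \<open>K\<close>, and the maximal condition passes up from \<open>K\<close> to \<open>H\<close>.\<close>

lemma fin_gen_transfer_abelian_extension:
  assumes res: "restrained G" and H: "subgroup H G" and "finite F"
    and "subgroup K G" "derived G H \<subseteq> K" "K \<subseteq> H" "F \<subseteq> H" "generate G (F \<union> K) = H"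
  shows "(fin_gen G H \<longrightarrow> fin_gen G K) \<and> (hereditarily_fin_gen G K \<longrightarrow> hereditarily_fin_gen G H)"
  using assms(3-)
proof (induction F arbitrary: K rule: finite_induct)
  case empty
  then have "K = H" using generate_subgroup_incl[of K K] by auto
  then show ?case by simp
next
  case (insert a F)
  let ?K = "generate G (insert a K)"
  have a: "a \<in> H" "a \<in> carrier G" using insert.prems subgroup.mem_carrier[OF H] by auto
  have inc: "insert a K \<subseteq> ?K" by (auto intro: generate.incl)
  have KH: "?K \<subseteq> H" using insert.prems a by (intro generate_subgroup_incl[OF _ H]) auto
  have sub: "subgroup ?K G"
    using a insert.prems subgroup.subset[OF H] by (intro generate_is_subgroup) auto
  have inv: "conj_pow G a i x \<in> K" if "x \<in> K" for i x
    using conj_pow_mem_of_derived_subset[OF H] insert.prems a(1) that by blast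
  have "generate G (F \<union> ?K) \<subseteq> H" using insert.prems KH by (intro generate_subgroup_incl[OF _ H]) auto
  moreover have "insert a F \<union> K \<subseteq> F \<union> ?K" using inc by blast
  ultimately have "generate G (F \<union> ?K) = H" using mono_generate insert.prems(5) by blast
  with insert.IH[OF sub] insert.prems inc KH
  have "(fin_gen G H \<longrightarrow> fin_gen G ?K) \<and> (hereditarily_fin_gen G ?K \<longrightarrow> hereditarily_fin_gen G H)"
    by blast
  moreover have "fin_gen G ?K \<Longrightarrow> fin_gen G K"
    by (rule fin_gen_cyclic_extension_imp_fin_gen[OF res insert.prems(1) a(2)]) (rule inv)
  moreover have "hereditarily_fin_gen G K \<Longrightarrow> hereditarily_fin_gen G ?K"
    by (rule hereditarily_fin_gen_cyclic_extension[OF insert.prems(1) a(2)]) (rule inv)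
  ultimately show ?case by blast
qed

text \<open>The derived subgroup inherits finite generation, so the derived length can be lowered.\<close>

theorem restrained_soluble_hereditarily_fin_gen:
  assumes res: "restrained G"
    and "subgroup H G" "fin_gen G H" "(derived G ^^ n) H = {\<one>}"
  shows "hereditarily_fin_gen G H"
  using assms(2-)
proof (induction n arbitrary: H)
  case 0
  have "fin_gen G S" if "subgroup S G" "S \<subseteq> {\<one>}" for S
    by (rule fin_genI[of "{}"]) (use that in \<open>auto intro: generate.one\<close>)
  then show ?case using 0 by (auto simp: hereditarily_fin_gen_def)
next
  case (Suc n)
  obtain F where F: "finite F" "F \<subseteq> carrier G" "generate G F = H"
    using Suc.prems(2) unfolding fin_gen_def by blast
  have FH: "F \<subseteq> H" unfolding F(3)[symmetric] by (rule subsetI) (rule generate.incl)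
  have D: "subgroup (derived G H) G" "derived G H \<subseteq> H"
    using derived_is_subgroup derived_incl[of H H] subgroup.subset[OF Suc.prems(1)] Suc.prems(1) by auto
  have "generate G (F \<union> derived G H) = H"
    using generate_subgroup_incl[OF _ Suc.prems(1), of "F \<union> derived G H"] FH D(2)
      mono_generate[of F "F \<union> derived G H"] F(3) by blast
  then have "(fin_gen G H \<longrightarrow> fin_gen G (derived G H)) \<and>
      (hereditarily_fin_gen G (derived G H) \<longrightarrow> hereditarily_fin_gen G H)"
    by (intro fin_gen_transfer_abelian_extension[OF res Suc.prems(1) F(1) D(1) _ D(2) FH]) auto
  moreover have "(derived G ^^ n) (derived G H) = {\<one>}" using Suc.prems(3) by (simp add: funpow_swap1)
  ultimately show ?case using Suc.IH[OF D(1)] Suc.prems(2) by blast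
qed

end

section \<open>Words in a sequence of group elements\<close>

text \<open>The letters follow the convention for free groups: \<open>(i, True)\<close> stands for \<open>u i\<close> and \<open>(i, False)\<close>
  for its inverse.  Explicit words are needed to state that one and the same relation holds for
  many sequences, possibly in different groups.\<close>

definition signed_word :: "('a, 'm) monoid_scheme \<Rightarrow> (nat \<Rightarrow> 'a) \<Rightarrow> (nat \<times> bool) list \<Rightarrow> 'a" where
  "signed_word K u = word_eval K (\<lambda>(i, b). if b then u i else inv\<^bsub>K\<^esub> (u i))"

lemma signed_word_Nil [simp]: "signed_word K u [] = \<one>\<^bsub>K\<^esub>"
  by (simp add: signed_word_def word_eval_def)

lemma signed_word_Cons [simp]:
  "signed_word K u ((i, b) # w) = (if b then u i else inv\<^bsub>K\<^esub> (u i)) \<otimes>\<^bsub>K\<^esub> signed_word K u w"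
  by (simp add: signed_word_def word_eval_def)

context group
begin

lemma signed_word_closed [intro, simp]:
  "(\<And>i. u i \<in> carrier G) \<Longrightarrow> signed_word G u w \<in> carrier G"
  by (induction w) auto

lemma signed_word_mem:
  assumes "subgroup L G" "\<And>i. i \<in> fst ` set w \<Longrightarrow> u i \<in> L"
  shows "signed_word G u w \<in> L"
  using assms(2)
  by (induction w)
    (auto simp: subgroup.one_closed[OF assms(1)] subgroup.m_inv_closed[OF assms(1)]
      intro!: subgroup.m_closed[OF assms(1)])

lemma signed_word_append:
  assumes "\<And>i. u i \<in> carrier G"
  shows "signed_word G u (v @ w) = signed_word G u v \<otimes> signed_word G u w"
  using assms by (induction v) (auto simp: m_assoc)

lemma generate_imp_signed_word:
  assumes "\<And>i. u i \<in> carrier G" "x \<in> generate G (u ` I)"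
  shows "\<exists>w. fst ` set w \<subseteq> I \<and> x = signed_word G u w"
  using assms(2)
proof (induction x rule: generate.induct)
  case one
  show ?case by (rule exI[of _ "[]"]) simp
next
  case (incl x)
  then obtain i where "i \<in> I" "x = u i" by blast
  then show ?case using assms(1) by (intro exI[of _ "[(i, True)]"]) simp
next
  case (inv x)
  then obtain i where "i \<in> I" "x = u i" by blast
  then show ?case using assms(1) by (intro exI[of _ "[(i, False)]"]) simp
next
  case (eng x y)
  then obtain v w where "fst ` set v \<subseteq> I" "x = signed_word G u v"
    "fst ` set w \<subseteq> I" "y = signed_word G u w" by blast
  then show ?case using assms(1) by (intro exI[of _ "v @ w"]) (auto simp: signed_word_append)
qed

lemma signed_word_one: "signed_word G (\<lambda>_. \<one>) w = \<one>"
  by (induction w) auto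

lemma signed_word_mult_commuting:
  assumes C: "subgroup C G" "\<And>x y. x \<in> C \<Longrightarrow> y \<in> C \<Longrightarrow> x \<otimes> y = y \<otimes> x"
    and uv: "\<And>i. u i \<in> C" "\<And>i. v i \<in> C"
  shows "signed_word G (\<lambda>i. u i \<otimes> v i) w = signed_word G u w \<otimes> signed_word G v w"
proof (induction w)
  case Nil
  then show ?case by simp
next
  case (Cons l w)
  obtain i b where l: "l = (i, b)" by (cases l)
  have swap: "(p \<otimes> q) \<otimes> (r \<otimes> s) = (p \<otimes> r) \<otimes> (q \<otimes> s)"
    if "p \<in> C" "q \<in> C" "r \<in> C" "s \<in> C" for p q r s
  proof -
    have "(p \<otimes> q) \<otimes> (r \<otimes> s) = p \<otimes> (q \<otimes> r) \<otimes> s"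
      using that subgroup.mem_carrier[OF C(1)] by (simp add: m_assoc)
    also have "\<dots> = (p \<otimes> r) \<otimes> (q \<otimes> s)"
      using that subgroup.mem_carrier[OF C(1)] C(2)[of q r] by (simp add: m_assoc)
    finally show ?thesis .
  qed
  have "inv (u i \<otimes> v i) = inv (u i) \<otimes> inv (v i)"
    using uv C(2)[of "u i" "v i"] subgroup.mem_carrier[OF C(1)] by (simp add: inv_mult_group)
  moreover have "signed_word G u w \<in> C" "signed_word G v w \<in> C"
    by (auto intro!: signed_word_mem[OF C(1)] uv)
  ultimately show ?case
    unfolding l using uv subgroup.m_inv_closed[OF C(1)] by (simp add: Cons.IH swap)
qed

end

lemma (in group_hom) hom_signed_word:
  assumes "\<And>i. u i \<in> carrier G"
  shows "h (signed_word G u w) = signed_word H (\<lambda>i. h (u i)) w"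
  using assms by (induction w) auto

section \<open>Uniformly restrained groups\<close>

text \<open>The order of the quantifiers is the point: since \<open>m\<close> and \<open>w\<close> serve all \<open>t\<close> at once, the relation
  can be applied pointwise when \<open>t\<close> runs through the values of a nonconstant function.\<close>

definition uniformly_restrained :: "('a, 'm) monoid_scheme \<Rightarrow> bool" where
  "uniformly_restrained K \<longleftrightarrow> (\<forall>a\<in>carrier K. \<exists>m w. fst ` set w \<subseteq> {..<m} \<and>
     (\<forall>t\<in>carrier K. conj_pow K t (int m) a = signed_word K (\<lambda>i. conj_pow K t (int i) a) w))"

context group
begin

lemma fin_gen_orbit_one: "h \<in> carrier G \<Longrightarrow> fin_gen_orbit G h \<one>"
  by (auto simp: fin_gen_orbit_def conj_pow_one intro: generate.one)

text \<open>The recurrence expresses each conjugate \<open>h\<^sup>j f h\<^sup>-\<^sup>j\<close> with \<open>j \<ge> m\<close> by the \<open>m\<close> preceding ones and a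
  conjugate of the error term \<open>g\<close>; the conjugates of \<open>g\<close> lie in a group generated by finitely
  many of them, which are themselves words in the conjugates of \<open>f\<close>.\<close>

lemma fin_gen_orbit_recurrence:
  assumes h: "h \<in> carrier G" and f: "f \<in> carrier G" and w: "fst ` set w \<subseteq> {..<m}"
    and orb: "fin_gen_orbit G h
      (conj_pow G h (int m) f \<otimes> inv (signed_word G (\<lambda>i. conj_pow G h (int i) f) w))"
      (is "fin_gen_orbit G h ?g")
  shows "fin_gen_orbit G h f"
proof -
  let ?u = "\<lambda>i. conj_pow G h (int i) f" and ?W = "\<lambda>j. signed_word G (\<lambda>i. conj_pow G h (int j + int i) f) w"
  obtain k where k: "\<And>j. conj_pow G h (int j) ?g \<in> generate G ((\<lambda>i. conj_pow G h (int i) ?g) ` {..<k::nat})"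
    using orb unfolding fin_gen_orbit_def by blast
  define L where "L = generate G (?u ` {..<m + k})"
  have L: "subgroup L G" unfolding L_def using h f by (intro generate_is_subgroup) auto
  have u: "?u i \<in> L" if "i < m + k" for i unfolding L_def using that by (intro generate.incl) auto
  have Wc: "?W j \<in> carrier G" for j using h f by auto
  \<comment> \<open>Conjugating the recurrence by \<open>h\<^sup>j\<close> shifts all indices by \<open>j\<close>.\<close>
  have shift: "conj_pow G h (int j) ?g = ?u (j + m) \<otimes> inv (?W j)" for j
  proof -
    interpret c: group_hom G G "conj_pow G h (int j)" by (rule group_hom_conj_pow[OF h])
    have "conj_pow G h (int j) (signed_word G ?u w) = ?W j"
      using h f by (simp add: c.hom_signed_word conj_pow_add)
    moreover have "signed_word G ?u w \<in> carrier G" using h f by auto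
    ultimately show ?thesis using h f
      by (simp add: conj_pow_mult conj_pow_inv conj_pow_add)
  qed
  have W: "?W j \<in> L" if "\<And>i. i < j + m \<Longrightarrow> ?u i \<in> L" for j
  proof (rule signed_word_mem[OF L])
    fix i assume "i \<in> fst ` set w"
    then have "?u (j + i) \<in> L" using w by (intro that) auto
    then show "conj_pow G h (int j + int i) f \<in> L" by simp
  qed
  have "(\<lambda>i. conj_pow G h (int i) ?g) ` {..<k} \<subseteq> L"
  proof (clarify)
    fix i assume i: "i < k"
    have "?W i \<in> L" by (rule W, rule u) (use i in simp)
    then show "conj_pow G h (int i) ?g \<in> L"
      unfolding shift using i by (intro subgroup.m_closed[OF L] u subgroup.m_inv_closed[OF L]) auto
  qed
  from generate_subgroup_incl[OF this L] have g: "conj_pow G h (int j) ?g \<in> L" for j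
    using k by blast
  have "?u j \<in> L" for j
  proof (induction j rule: less_induct)
    case (less j)
    show ?case
    proof (cases "j < m")
      case True
      then show ?thesis by (intro u) simp
    next
      case False
      define i where "i = j - m"
      have j: "j = i + m" using False by (simp add: i_def)
      have Wi: "?W i \<in> L"
      proof (rule W)
        fix i' assume "i' < i + m"
        then show "?u i' \<in> L" using less j by simp
      qed
      have "?u j \<otimes> inv (?W i) \<in> L" using g[of i] unfolding shift j .
      from subgroup.m_closed[OF L this Wi] have "?u j \<otimes> inv (?W i) \<otimes> ?W i \<in> L" .
      then show ?thesis using h f Wc by (simp add: m_assoc)
    qed
  qed
  then show ?thesis unfolding fin_gen_orbit_def L_def by blast
qed

end

text \<open>Solutions of the recurrence modulo the kernel of \<open>h\<close> can be multiplied and inverted, because their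
  images lie in the abelian group \<open>h ` D\<close> and words are additive on commuting arguments.  The subgroup is normal because conjugating by \<open>g\<close> only replaces \<open>t\<close> by \<open>g\<^sup>-\<^sup>1 t g\<close>.\<close>

lemma (in group_hom) normal_recurrence_subgroup:
  assumes D: "D \<lhd> G"
    and comm: "\<And>x y. x \<in> D \<Longrightarrow> y \<in> D \<Longrightarrow> h x \<otimes>\<^bsub>H\<^esub> h y = h y \<otimes>\<^bsub>H\<^esub> h x"
  shows "{y \<in> carrier G. h y \<in> h ` D \<and> (\<forall>t\<in>carrier G.
      h (conj_pow G t (int m) y) = signed_word H (\<lambda>i. h (conj_pow G t (int i) y)) w)} \<lhd> G"
    (is "?N \<lhd> G")
proof -
  interpret D: normal D G by (rule D)
  have C: "subgroup (h ` D) H" by (rule subgroup_img_is_subgroup[OF D.subgroup_axioms])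
  have commC: "p \<otimes>\<^bsub>H\<^esub> q = q \<otimes>\<^bsub>H\<^esub> p" if "p \<in> h ` D" "q \<in> h ` D" for p q
    using that comm by blast
  have conjC: "h (conj_pow G t i y) \<in> h ` D" if "t \<in> carrier G" "y \<in> carrier G" "h y \<in> h ` D" for t i y
  proof -
    from that(3) obtain d where d: "h y = h d" "d \<in> D" by (rule imageE)
    then have "h (conj_pow G t i y) = h (conj_pow G t i d)"
      using that D.subset by (simp add: hom_conj_pow subset_iff)
    moreover have "conj_pow G t i d \<in> D"
      unfolding conj_pow_def using d that by (intro D.inv_op_closed2) auto
    ultimately show ?thesis by (simp add: imageI)
  qed
  have mult: "x \<otimes> y \<in> ?N" if x: "x \<in> ?N" and y: "y \<in> ?N" for x y
  proof -
    have c: "x \<in> carrier G" "y \<in> carrier G" using x y by auto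
    have "h (conj_pow G t (int m) (x \<otimes> y)) = signed_word H (\<lambda>i. h (conj_pow G t (int i) (x \<otimes> y))) w"
      if t: "t \<in> carrier G" for t
    proof -
      have "signed_word H (\<lambda>i. h (conj_pow G t (int i) (x \<otimes> y))) w
          = signed_word H (\<lambda>i. h (conj_pow G t (int i) x) \<otimes>\<^bsub>H\<^esub> h (conj_pow G t (int i) y)) w"
        using c t by (simp add: G.conj_pow_mult)
      also have "\<dots> = signed_word H (\<lambda>i. h (conj_pow G t (int i) x)) w
          \<otimes>\<^bsub>H\<^esub> signed_word H (\<lambda>i. h (conj_pow G t (int i) y)) w"
        by (rule H.signed_word_mult_commuting[OF C commC]) (use x y t conjC in auto)
      finally show ?thesis using x y t c by (simp add: G.conj_pow_mult)
    qed
    moreover have "h (x \<otimes> y) \<in> h ` D" using x y c subgroup.m_closed[OF C] by simp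
    ultimately show ?thesis using c by simp
  qed
  have inverse: "inv x \<in> ?N" if x: "x \<in> ?N" for x
  proof -
    have c: "x \<in> carrier G" using x by auto
    have xD: "h (inv x) \<in> h ` D" using x c subgroup.m_inv_closed[OF C] by simp
    have "h (conj_pow G t (int m) (inv x)) = signed_word H (\<lambda>i. h (conj_pow G t (int i) (inv x))) w"
      (is "_ = ?W'") if t: "t \<in> carrier G" for t
    proof -
      have "?W' \<otimes>\<^bsub>H\<^esub> signed_word H (\<lambda>i. h (conj_pow G t (int i) x)) w
          = signed_word H (\<lambda>i. h (conj_pow G t (int i) (inv x)) \<otimes>\<^bsub>H\<^esub> h (conj_pow G t (int i) x)) w"
        by (rule H.signed_word_mult_commuting[OF C commC, symmetric]) (use x xD t c conjC in auto)
      also have "\<dots> = \<one>\<^bsub>H\<^esub>" using c t by (simp add: G.conj_pow_inv H.signed_word_one)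
      finally have "?W' = inv\<^bsub>H\<^esub> (signed_word H (\<lambda>i. h (conj_pow G t (int i) x)) w)"
        using c t by (intro H.inv_equality[symmetric]) auto
      then show ?thesis using x t c by (simp add: G.conj_pow_inv)
    qed
    then show ?thesis using c xD by simp
  qed
  have conj: "conj_pow G g 1 x \<in> ?N" if g: "g \<in> carrier G" and x: "x \<in> ?N" for g x
  proof -
    have c: "x \<in> carrier G" using x by auto
    interpret k: group_hom H H "conj_pow H (h g) 1" using g by (intro H.group_hom_conj_pow) auto
    interpret l: group_hom G G "conj_pow G g (- 1)" using g by (intro G.group_hom_conj_pow) auto
    have "h (conj_pow G t (int m) (conj_pow G g 1 x))
        = signed_word H (\<lambda>i. h (conj_pow G t (int i) (conj_pow G g 1 x))) w"
      if t: "t \<in> carrier G" for t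
    proof -
      define s where "s = conj_pow G g (- 1) t"
      have s: "s \<in> carrier G" using g t by (auto simp: s_def)
      have swap: "conj_pow G t i (conj_pow G g 1 x) = conj_pow G g 1 (conj_pow G s i x)" for i
      proof -
        interpret l': group_hom G G "conj_pow G g 1" using g by (intro G.group_hom_conj_pow) auto
        have "conj_pow G g 1 s = t" unfolding s_def using g t by (simp add: G.conj_pow_add)
        then show ?thesis using l'.hom_conj_pow[OF s c] by simp
      qed
      have "h (conj_pow G t i (conj_pow G g 1 x)) = conj_pow H (h g) 1 (h (conj_pow G s i x))" for i
        unfolding swap using g s c by (intro hom_conj_pow) auto
      moreover have "h (conj_pow G s (int m) x) = signed_word H (\<lambda>i. h (conj_pow G s (int i) x)) w"
        using x s by blast
      moreover have "conj_pow H (h g) 1 (signed_word H (\<lambda>i. h (conj_pow G s (int i) x)) w)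
          = signed_word H (\<lambda>i. conj_pow H (h g) 1 (h (conj_pow G s (int i) x))) w"
        using s c by (intro k.hom_signed_word) auto
      ultimately show ?thesis by simp
    qed
    moreover have "h (conj_pow G g 1 x) \<in> h ` D" using x g by (intro conjC) auto
    ultimately show ?thesis using c g by simp
  qed
  show ?thesis
  proof (rule G.normal_invI)
    show "subgroup ?N G"
    proof (rule G.subgroupI)
      have "\<one> \<in> ?N"
        using subgroup.one_closed[OF C] by (simp add: G.conj_pow_one H.signed_word_one)
      then show "?N \<noteq> {}" by blast
    qed (use mult inverse in blast)+
    show "g \<otimes> x \<otimes> inv g \<in> ?N" if "g \<in> carrier G" "x \<in> ?N" for g x
      using conj[OF that] that by (simp add: conj_pow_def)
  qed
qed

text \<open>Take a normal subgroup \<open>N\<close> maximal among those for which every element of \<open>P\<close> with values in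
  \<open>N\<close> has finitely generated orbits.  If \<open>N\<close> were proper, some term \<open>D\<close> of the derived series would
  give a nontrivial abelian section \<open>D N / N\<close>.  An element \<open>a \<in> D - N\<close> satisfies a recurrence that is
  uniform in \<open>t\<close>, and the elements of \<open>D N\<close> satisfying the same recurrence modulo \<open>N\<close> form a normal
  subgroup \<open>M\<close>.  If \<open>f\<close> has values in \<open>M\<close>, the recurrence holds for \<open>f\<close> and any \<open>h\<close> at every point, up
  to an error with values in \<open>N\<close>; hence \<open>f\<close> has finitely generated orbits, and \<open>M\<close> contradicts the
  maximality of \<open>N\<close>.\<close>

theorem restrained_of_separating_homs:
  assumes noeth: "noetherian_group G" and sol: "solvable G" and unif: "uniformly_restrained G"
    and P: "group P" and E: "\<And>e. e \<in> E \<Longrightarrow> e \<in> hom P G"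
    and sep: "\<And>f. f \<in> carrier P \<Longrightarrow> (\<And>e. e \<in> E \<Longrightarrow> e f = \<one>\<^bsub>G\<^esub>) \<Longrightarrow> f = \<one>\<^bsub>P\<^esub>"
  shows "restrained P"
proof -
  interpret G: group G using noeth by (simp add: noetherian_group_def)
  interpret P: group P by (rule P)
  have ghom: "group_hom P G e" if "e \<in> E" for e
    using E[OF that] by unfold_locales
  define good where "good N \<longleftrightarrow> (\<forall>f\<in>carrier P. \<forall>h\<in>carrier P.
    (\<forall>e\<in>E. e f \<in> N) \<longrightarrow> fin_gen_orbit P h f)" for N
  have "good {\<one>\<^bsub>G\<^esub>}" unfolding good_def
  proof (intro ballI impI)
    fix f h assume "f \<in> carrier P" "h \<in> carrier P" "\<forall>e\<in>E. e f \<in> {\<one>\<^bsub>G\<^esub>}"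
    moreover from this have "f = \<one>\<^bsub>P\<^esub>" by (intro sep) auto
    ultimately show "fin_gen_orbit P h f" using P.fin_gen_orbit_one by simp
  qed
  then have "{N. N \<lhd> G \<and> good N} \<noteq> {}" using G.one_is_normal by blast
  moreover have "\<forall>N\<in>{N. N \<lhd> G \<and> good N}. subgroup N G" using normal_imp_subgroup by blast
  ultimately obtain N where N: "N \<lhd> G" "good N"
    and max: "\<And>M. M \<lhd> G \<Longrightarrow> good M \<Longrightarrow> N \<subseteq> M \<Longrightarrow> M = N"
    using noeth unfolding noetherian_group_def by (smt (verit) mem_Collect_eq)
  interpret N: normal N G by (rule N(1))
  have "N = carrier G"
  proof (rule ccontr)
    assume "N \<noteq> carrier G"
    then have "\<not> (derived G ^^ 0) (carrier G) \<subseteq> N" using N.subset by auto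
    moreover obtain l where "(derived G ^^ l) (carrier G) = {\<one>\<^bsub>G\<^esub>}"
      using sol unfolding G.solvable_iff_trivial_derived_seq by blast
    then have "(derived G ^^ l) (carrier G) \<subseteq> N" using N.one_closed by simp
    ultimately obtain d where d: "\<not> (derived G ^^ d) (carrier G) \<subseteq> N"
      "(derived G ^^ Suc d) (carrier G) \<subseteq> N"
      using ex_least_nat_less[of "\<lambda>d. (derived G ^^ d) (carrier G) \<subseteq> N" l] by blast
    define D where "D = (derived G ^^ d) (carrier G)"
    have D: "D \<lhd> G" unfolding D_def
      by (induction d) (auto intro: G.normal_self G.derived_is_normal)
    interpret D: normal D G by (rule D)
    obtain a where a: "a \<in> D" "a \<notin> N" using d(1) unfolding D_def by blast
    from unif[unfolded uniformly_restrained_def, THEN bspec, OF D.mem_carrier[OF a(1)]]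
    obtain m w where w: "fst ` set w \<subseteq> {..<m}"
      and rec: "\<forall>t\<in>carrier G. conj_pow G t (int m) a = signed_word G (\<lambda>i. conj_pow G t (int i) a) w"
      by (elim exE conjE)
    define \<pi> where "\<pi> y = N #>\<^bsub>G\<^esub> y" for y
    define Q where "Q = G Mod N"
    interpret Q: group Q unfolding Q_def by (rule N.factorgroup_is_group)
    interpret \<rho>: group_hom G Q \<pi>
      using N.r_coset_hom_Mod by unfold_locales (simp add: Q_def \<pi>_def[abs_def])
    have ker: "\<pi> y = \<one>\<^bsub>Q\<^esub> \<longleftrightarrow> y \<in> N" if "y \<in> carrier G" for y
      using that G.coset_join1[of N y] G.coset_join2[of y N] N.subgroup_axioms
      by (auto simp: FactGroup_def Q_def \<pi>_def)
    have ker_diff: "p \<otimes>\<^bsub>G\<^esub> inv\<^bsub>G\<^esub> q \<in> N \<longleftrightarrow> \<pi> p = \<pi> q" if "p \<in> carrier G" "q \<in> carrier G" for p q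
      using ker[of "p \<otimes>\<^bsub>G\<^esub> inv\<^bsub>G\<^esub> q"] that by (simp add: Q.inv_solve_right')
    have comm: "\<pi> x \<otimes>\<^bsub>Q\<^esub> \<pi> y = \<pi> y \<otimes>\<^bsub>Q\<^esub> \<pi> x" if xy: "x \<in> D" "y \<in> D" for x y
    proof -
      have c: "x \<in> carrier G" "y \<in> carrier G" using xy D.subset by auto
      have "x \<otimes>\<^bsub>G\<^esub> y \<otimes>\<^bsub>G\<^esub> inv\<^bsub>G\<^esub> x \<otimes>\<^bsub>G\<^esub> inv\<^bsub>G\<^esub> y \<in> derived_set G D" using xy by blast
      then have "x \<otimes>\<^bsub>G\<^esub> y \<otimes>\<^bsub>G\<^esub> inv\<^bsub>G\<^esub> x \<otimes>\<^bsub>G\<^esub> inv\<^bsub>G\<^esub> y \<in> N"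
        using d(2) unfolding D_def derived_def by (auto intro: generate.incl)
      then have "x \<otimes>\<^bsub>G\<^esub> y \<otimes>\<^bsub>G\<^esub> inv\<^bsub>G\<^esub> (y \<otimes>\<^bsub>G\<^esub> x) \<in> N"
        using c by (simp add: G.inv_mult_group G.m_assoc)
      then have "\<pi> (x \<otimes>\<^bsub>G\<^esub> y) = \<pi> (y \<otimes>\<^bsub>G\<^esub> x)" using ker_diff c by simp
      then show ?thesis using c by (simp only: \<rho>.hom_mult)
    qed
    define M where "M = {y \<in> carrier G. \<pi> y \<in> \<pi> ` D \<and> (\<forall>t\<in>carrier G.
      \<pi> (conj_pow G t (int m) y) = signed_word Q (\<lambda>i. \<pi> (conj_pow G t (int i) y)) w)}"
    have "M \<lhd> G" unfolding M_def by (rule \<rho>.normal_recurrence_subgroup[OF D comm])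
    moreover have "N \<subseteq> M"
    proof
      fix y assume y: "y \<in> N"
      then have c: "y \<in> carrier G" by (rule N.mem_carrier)
      have "\<pi> (conj_pow G t i y) = \<one>\<^bsub>Q\<^esub>" if "t \<in> carrier G" for t i
        using y c that N.inv_op_closed2[of "t [^]\<^bsub>G\<^esub> i" y] ker[of "conj_pow G t i y"]
        by (simp add: conj_pow_def)
      moreover have "\<pi> y \<in> \<pi> ` D"
        using ker[OF c] y \<rho>.hom_one D.one_closed by (metis image_eqI)
      ultimately show "y \<in> M" using c by (simp add: M_def Q.signed_word_one)
    qed
    moreover have "good M" unfolding good_def
    proof (intro ballI impI)
      fix f h assume f: "f \<in> carrier P" and h: "h \<in> carrier P" and fM: "\<forall>e\<in>E. e f \<in> M"
      let ?W = "signed_word P (\<lambda>i. conj_pow P h (int i) f) w"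
      have Wc: "?W \<in> carrier P" using f h by auto
      show "fin_gen_orbit P h f"
      proof (rule P.fin_gen_orbit_recurrence[OF h f w])
        have "e (conj_pow P h (int m) f \<otimes>\<^bsub>P\<^esub> inv\<^bsub>P\<^esub> ?W) \<in> N" if e: "e \<in> E" for e
        proof -
          interpret e: group_hom P G e by (rule ghom[OF e])
          have c: "e f \<in> carrier G" "e h \<in> carrier G" using f h by auto
          have W: "signed_word G (\<lambda>i. conj_pow G (e h) (int i) (e f)) w \<in> carrier G" using c by auto
          have "\<pi> (conj_pow G (e h) (int m) (e f))
              = \<pi> (signed_word G (\<lambda>i. conj_pow G (e h) (int i) (e f)) w)"
            using fM e c by (simp add: \<rho>.hom_signed_word M_def)
          then have "conj_pow G (e h) (int m) (e f)
              \<otimes>\<^bsub>G\<^esub> inv\<^bsub>G\<^esub> signed_word G (\<lambda>i. conj_pow G (e h) (int i) (e f)) w \<in> N"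
            using ker_diff c W by simp
          moreover have "e ?W = signed_word G (\<lambda>i. conj_pow G (e h) (int i) (e f)) w"
            using f h by (simp add: e.hom_signed_word e.hom_conj_pow)
          ultimately show ?thesis using f h Wc by (simp add: e.hom_conj_pow)
        qed
        then show "fin_gen_orbit P h (conj_pow P h (int m) f \<otimes>\<^bsub>P\<^esub> inv\<^bsub>P\<^esub> ?W)"
          using N(2) f h Wc unfolding good_def by simp
      qed
    qed
    ultimately have "M = N" using max by blast
    moreover have "a \<in> M"
    proof -
      have "\<pi> (conj_pow G t (int m) a) = signed_word Q (\<lambda>i. \<pi> (conj_pow G t (int i) a)) w"
        if "t \<in> carrier G" for t
        unfolding rec[rule_format, OF that] using that D.mem_carrier[OF a(1)] by (intro \<rho>.hom_signed_word) auto
      then show ?thesis using a(1) D.mem_carrier[OF a(1)] by (simp add: M_def)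
    qed
    ultimately show False using a(2) by blast
  qed
  then show ?thesis
    using N(2) hom_in_carrier[OF E] unfolding restrained_def good_def by simp
qed

text \<open>Homomorphisms carry the derived series of \<open>P\<close> into that of \<open>G\<close>, so \<open>P\<close> has at most the derived
  length of \<open>G\<close>.\<close>

lemma solvable_of_separating_homs:
  assumes G: "group G" and sol: "solvable G" and P: "group P"
    and E: "\<And>e. e \<in> E \<Longrightarrow> e \<in> hom P G"
    and sep: "\<And>f. f \<in> carrier P \<Longrightarrow> (\<And>e. e \<in> E \<Longrightarrow> e f = \<one>\<^bsub>G\<^esub>) \<Longrightarrow> f = \<one>\<^bsub>P\<^esub>"
  shows "solvable P"
proof -
  interpret G: group G by (rule G)
  interpret P: group P by (rule P)
  obtain n where n: "(derived G ^^ n) (carrier G) = {\<one>\<^bsub>G\<^esub>}"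
    using sol unfolding G.solvable_iff_trivial_derived_seq by blast
  have sub: "subgroup ((derived P ^^ n) (carrier P)) P"
    by (rule P.exp_of_derived_is_subgroup[OF P.subgroup_self])
  have "f = \<one>\<^bsub>P\<^esub>" if f: "f \<in> (derived P ^^ n) (carrier P)" for f
  proof (rule sep)
    show "f \<in> carrier P" using f subgroup.subset[OF sub] by blast
    fix e assume e: "e \<in> E"
    interpret e: group_hom P G e using E[OF e] by unfold_locales
    have "e f \<in> (derived G ^^ n) (e ` carrier P)"
      using e.exp_of_derived_img[of "carrier P" n] f by blast
    moreover have "\<dots> \<subseteq> (derived G ^^ n) (carrier G)" by (rule G.mono_exp_of_derived) auto
    ultimately show "e f = \<one>\<^bsub>G\<^esub>" using n by blast
  qed
  then have "(derived P ^^ n) (carrier P) = {\<one>\<^bsub>P\<^esub>}" using subgroup.one_closed[OF sub] by blast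
  then show ?thesis using P.solvable_iff_trivial_derived_seq by blast
qed

section \<open>Groups of polynomial functions\<close>

definition const_function :: "('a, 'm) monoid_scheme \<Rightarrow> nat \<Rightarrow> 'a \<Rightarrow> (nat \<Rightarrow> 'a) \<Rightarrow> 'a" where
  "const_function G n g = polynomial_function G n (polynomial_const G n g)"

definition var_function :: "('a, 'm) monoid_scheme \<Rightarrow> nat \<Rightarrow> nat \<Rightarrow> (nat \<Rightarrow> 'a) \<Rightarrow> 'a" where
  "var_function G n i = polynomial_function G n (polynomial_var G n i)"

lemma polynomial_function_group_hom:
  assumes "group G"
  shows "group_hom (group_polynomials G n) (polynomial_functions G n) (polynomial_function G n)"
  using group_polynomial_functions[OF assms] group_group_polynomials[OF assms]
    polynomial_function_hom(1)[OF assms]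
  by (auto intro!: group_hom.intro group_hom_axioms.intro homI simp: polynomial_functions_def)

lemma const_function_group_hom:
  assumes "group G"
  shows "group_hom G (polynomial_functions G n) (const_function G n)"
  using group_polynomial_functions[OF assms] assms
    hom_compose[OF polynomial_const_hom[OF assms] group_hom.homh[OF polynomial_function_group_hom[OF assms]]]
  by (auto intro!: group_hom.intro group_hom_axioms.intro simp: const_function_def[abs_def] comp_def)

lemma var_function_closed:
  "i \<in> {1..n} \<Longrightarrow> var_function G n i \<in> carrier (polynomial_functions G n)"
  using polynomial_var_carrier[of i n G] by (simp add: var_function_def polynomial_functions_def)

lemma evaluation_hom:
  assumes "group G" "t \<in> group_power G n"
  shows "(\<lambda>p. p t) \<in> hom (polynomial_functions G n) G"
proof (rule homI)
  show "p t \<in> carrier G" if "p \<in> carrier (polynomial_functions G n)" for p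
    using that assms(2) hom_in_carrier[OF polynomial_subst_hom[OF assms]]
    by (auto simp: polynomial_functions_def polynomial_function_def)
qed (use assms(2) in \<open>simp add: polynomial_functions_def\<close>)

lemma const_function_apply:
  "group G \<Longrightarrow> t \<in> group_power G n \<Longrightarrow> g \<in> carrier G \<Longrightarrow> const_function G n g t = g"
  by (simp add: const_function_def polynomial_function_def polynomial_subst_const)

lemma var_function_apply:
  "group G \<Longrightarrow> t \<in> group_power G n \<Longrightarrow> i \<in> {1..n} \<Longrightarrow> var_function G n i t = t i"
  by (simp add: var_function_def polynomial_function_def polynomial_subst_var)

text \<open>The universal properties of \<open>F\<^sub>n\<close> and of the free product give a homomorphism from the
  polynomials into any subgroup that contains the constants and the variables; by uniqueness it
  sends each polynomial to its polynomial function.\<close>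

lemma polynomial_functions_subgroup_eq:
  assumes G: "group G" and H: "subgroup H (polynomial_functions G n)"
    and const: "\<And>g. g \<in> carrier G \<Longrightarrow> const_function G n g \<in> H"
    and var: "\<And>i. i \<in> {1..n} \<Longrightarrow> var_function G n i \<in> H"
  shows "H = carrier (polynomial_functions G n)"
proof
  let ?P = "polynomial_functions G n" and ?F = "free_group {1..n}"
  let ?PH = "?P\<lparr>carrier := H\<rparr>"
  let ?c = "\<lambda>b. free_product_class G ?F (Inr b)"
  interpret P: group ?P by (rule group_polynomial_functions[OF G])
  interpret PH: group ?PH by (rule P.subgroup_imp_group[OF H])
  interpret \<phi>: group_hom "group_polynomials G n" ?P "polynomial_function G n"
    by (rule polynomial_function_group_hom[OF G])
  interpret c: group_hom G ?P "const_function G n" by (rule const_function_group_hom[OF G])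
  show "H \<subseteq> carrier ?P" by (rule subgroup.subset[OF H])
  have c_hom: "const_function G n \<in> hom G ?PH"
    using const c.hom_mult by (intro homI) auto
  have var_carrier: "var_function G n i \<in> carrier ?PH" if "i \<in> {1..n}" for i
    using var[OF that] by simp
  note F = free_group_lift_hom[OF PH.is_group, of "{1..n}" "var_function G n"]
  let ?\<psi> = "free_group_lift ?PH (var_function G n)"
  let ?h = "free_product_lift ?PH (const_function G n) ?\<psi>"
  have \<psi>: "?\<psi> \<in> hom ?F ?PH" by (rule F(1)) (rule var_carrier)
  have \<psi>_gen: "?\<psi> (free_group_gen {1..n} i) = var_function G n i" if "i \<in> {1..n}" for i
    by (rule F(2)[OF _ that]) (rule var_carrier)
  note L = free_product_lift_hom[OF G group_free_group PH.is_group c_hom \<psi>]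
  have to_P: "k \<in> hom K ?P" if "k \<in> hom K ?PH" for k and K :: "('z, 'w) monoid_scheme"
    using that subgroup.subset[OF H] by (auto simp: hom_def Pi_def)
  have var_eq: "?\<psi> b = polynomial_function G n (?c b)" if "b \<in> carrier ?F" for b
    using P.is_group to_P[OF \<psi>] _ _ that
  proof (rule free_group_hom_eqI)
    show "(\<lambda>b. polynomial_function G n (?c b)) \<in> hom ?F ?P"
      using hom_compose[OF free_product_class_hom(2)[OF G group_free_group]
          \<phi>.homh[unfolded group_polynomials_def]]
      by (simp add: comp_def)
    show "?\<psi> (free_group_gen {1..n} i) = polynomial_function G n (?c (free_group_gen {1..n} i))"
      if "i \<in> {1..n}" for i
      using \<psi>_gen[OF that] by (simp only: var_function_def polynomial_var_def)
  qed
  have "?h A = polynomial_function G n A" if "A \<in> carrier (group_polynomials G n)" for A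
    using G group_free_group P.is_group to_P[OF L(1)] \<phi>.homh[unfolded group_polynomials_def] _ _
      that[unfolded group_polynomials_def]
  proof (rule free_product_hom_eqI)
    show "?h (free_product_class G ?F (Inl a)) = polynomial_function G n (free_product_class G ?F (Inl a))"
      if "a \<in> carrier G" for a
      using L(2)[OF that] by (simp add: const_function_def polynomial_const_def)
    show "?h (?c b) = polynomial_function G n (?c b)" if "b \<in> carrier ?F" for b
      using L(3)[OF that] var_eq[OF that] by simp
  qed
  moreover have "?h A \<in> H" if "A \<in> carrier (group_polynomials G n)" for A
    using hom_in_carrier[OF L(1)] that by (simp add: group_polynomials_def)
  ultimately show "carrier ?P \<subseteq> H" by (auto simp: polynomial_functions_def)
qed

lemma fin_gen_polynomial_functions:
  assumes G: "group G" and fg: "fin_gen G (carrier G)"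
  shows "fin_gen (polynomial_functions G n) (carrier (polynomial_functions G n))"
proof -
  let ?P = "polynomial_functions G n"
  interpret P: group ?P by (rule group_polynomial_functions[OF G])
  interpret c: group_hom G ?P "const_function G n" by (rule const_function_group_hom[OF G])
  obtain F where F: "finite F" "F \<subseteq> carrier G" "generate G F = carrier G"
    using fg unfolding fin_gen_def by blast
  let ?X = "const_function G n ` F \<union> var_function G n ` {1..n}"
  have X: "?X \<subseteq> carrier ?P" using F(2) var_function_closed[of _ n G] by auto
  have "generate ?P ?X = carrier ?P"
  proof (rule polynomial_functions_subgroup_eq[OF G P.generate_is_subgroup[OF X]])
    fix g assume "g \<in> carrier G"
    then have "const_function G n g \<in> generate ?P (const_function G n ` F)"
      using c.generate_img[OF F(2)] F(3) by auto
    then show "const_function G n g \<in> generate ?P ?X"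
      using P.mono_generate[of "const_function G n ` F" ?X] by blast
  qed (auto intro: generate.incl)
  moreover have "finite ?X" using F(1) by simp
  ultimately show ?thesis using X unfolding fin_gen_def by (intro exI[of _ ?X] conjI)
qed

text \<open>Applied to the orbit of a constant \<open>a\<close> under the variable \<open>x\<close>, the ascending chain condition
  yields a relation between functions of \<open>x\<close>, which holds at every \<open>t \<in> G\<close> simultaneously.\<close>

lemma uniformly_restrained_of_noetherian_polynomial_functions:
  assumes G: "group G" and noeth: "noetherian_group (polynomial_functions G 1)"
  shows "uniformly_restrained G"
  unfolding uniformly_restrained_def
proof
  let ?P = "polynomial_functions G 1"
  interpret G: group G by (rule G)
  interpret P: group ?P by (rule group_polynomial_functions[OF G])
  interpret c: group_hom G ?P "const_function G 1" by (rule const_function_group_hom[OF G])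
  fix a assume a: "a \<in> carrier G"
  define x where "x = var_function G 1 1"
  have x: "x \<in> carrier ?P" unfolding x_def by (rule var_function_closed) simp
  define u where "u i = conj_pow ?P x (int i) (const_function G 1 a)" for i
  have u: "u i \<in> carrier ?P" for i unfolding u_def by (intro P.conj_pow_closed c.hom_closed x a)
  obtain k where "u k \<in> generate ?P (u ` {..<k})"
    using P.noetherian_sequence_generate[OF noeth, of u] u by blast
  with u obtain w where w: "fst ` set w \<subseteq> {..<k}" "u k = signed_word ?P u w"
    using P.generate_imp_signed_word[of u "u k" "{..<k}"] by blast
  have "conj_pow G t (int k) a = signed_word G (\<lambda>i. conj_pow G t (int i) a) w"
    if t: "t \<in> carrier G" for t
  proof -
    define \<tau> where "\<tau> = (\<lambda>i\<in>{1..1::nat}. t)"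
    have \<tau>: "\<tau> \<in> group_power G 1" using t by (auto simp: \<tau>_def group_power_def)
    interpret e: group_hom ?P G "\<lambda>p. p \<tau>" using evaluation_hom[OF G \<tau>] by unfold_locales
    have "x \<tau> = t" unfolding x_def using var_function_apply[OF G \<tau>, of 1] by (simp add: \<tau>_def del: One_nat_def)
    moreover have "const_function G 1 a \<tau> = a" by (rule const_function_apply[OF G \<tau> a])
    ultimately have u_eval: "u i \<tau> = conj_pow G t (int i) a" for i
      using e.hom_conj_pow[OF x c.hom_closed[OF a]] by (simp add: u_def del: One_nat_def)
    have "u k \<tau> = signed_word G (\<lambda>i. u i \<tau>) w"
      unfolding w(2) using e.hom_signed_word[of u w] u by simp
    then show ?thesis by (simp add: u_eval)
  qed
  then show "\<exists>m w. fst ` set w \<subseteq> {..<m} \<and>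
      (\<forall>t\<in>carrier G. conj_pow G t (int m) a = signed_word G (\<lambda>i. conj_pow G t (int i) a) w)"
    using w(1) by blast
qed

theorem corollary1p1:
  fixes G :: "('a, 'm) monoid_scheme" and n :: nat
  assumes "group G"
    and "polycyclic_group (polynomial_functions G 1)"
    and "n \<ge> 1"
  shows "polycyclic_group (polynomial_functions G n)"
proof -
  let ?P = "polynomial_functions G n"
  interpret G: group G by fact
  interpret P: group ?P by (rule group_polynomial_functions) fact
  interpret P1: group "polynomial_functions G 1" by (rule group_polynomial_functions) fact
  have noeth1: "noetherian_group (polynomial_functions G 1)" and sol1: "solvable (polynomial_functions G 1)"
    using assms(2) by (auto simp: polycyclic_group_def)

  \<comment> \<open>Evaluation at a point maps the polynomial functions in one variable onto \<open>G\<close>.\<close>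
  define \<tau> where "\<tau> = (\<lambda>i\<in>{1..1::nat}. \<one>\<^bsub>G\<^esub>)"
  have \<tau>: "\<tau> \<in> group_power G 1" by (auto simp: \<tau>_def group_power_def)
  interpret e: group_hom "polynomial_functions G 1" G "\<lambda>p. p \<tau>"
    using evaluation_hom[OF assms(1) \<tau>] by unfold_locales
  have "g \<in> (\<lambda>p. p \<tau>) ` carrier (polynomial_functions G 1)" if "g \<in> carrier G" for g
    using const_function_apply[OF assms(1) \<tau> that]
      group_hom.hom_closed[OF const_function_group_hom[OF assms(1)] that, of 1]
    by (metis image_eqI)
  then have surj: "(\<lambda>p. p \<tau>) ` carrier (polynomial_functions G 1) = carrier G"
    using e.hom_closed by blast
  have noeth: "noetherian_group G" by (rule e.noetherian_image[OF noeth1 surj])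
  have sol: "solvable G" by (rule e.surj_hom_imp_solvable[OF surj sol1])

  let ?E = "(\<lambda>t p. p t) ` group_power G n"
  have E: "\<epsilon> \<in> hom ?P G" if "\<epsilon> \<in> ?E" for \<epsilon>
    using that evaluation_hom[OF assms(1)] by blast
  have sep: "p = \<one>\<^bsub>?P\<^esub>" if p: "p \<in> carrier ?P" "\<And>\<epsilon>. \<epsilon> \<in> ?E \<Longrightarrow> \<epsilon> p = \<one>\<^bsub>G\<^esub>" for p
  proof
    fix t
    show "p t = \<one>\<^bsub>?P\<^esub> t"
    proof (cases "t \<in> group_power G n")
      case True
      then show ?thesis using p(2)[of "\<lambda>p. p t"] by (simp add: polynomial_functions_def)
    next
      case False
      then show ?thesis using p(1) by (auto simp: polynomial_functions_def polynomial_function_def)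
    qed
  qed
  have "restrained ?P"
    by (rule restrained_of_separating_homs[OF noeth sol
          uniformly_restrained_of_noetherian_polynomial_functions[OF assms(1) noeth1] P.is_group E sep])
  moreover have sol_P: "solvable ?P"
    by (rule solvable_of_separating_homs[OF assms(1) sol P.is_group E sep])
  moreover from sol_P obtain d where "(derived ?P ^^ d) (carrier ?P) = {\<one>\<^bsub>?P\<^esub>}"
    unfolding P.solvable_iff_trivial_derived_seq by blast
  moreover have "fin_gen ?P (carrier ?P)"
    by (rule fin_gen_polynomial_functions[OF assms(1) G.noetherian_imp_fin_gen[OF noeth]])
  ultimately have "hereditarily_fin_gen ?P (carrier ?P)"
    using P.restrained_soluble_hereditarily_fin_gen P.subgroup_self by blast
  then have "noetherian_group ?P" by (rule P.hereditarily_fin_gen_imp_noetherian)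
  then show ?thesis using sol_P by (simp add: polycyclic_group_def)
qed

end
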